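(* For every integer $n\ge0$, the coefficient of $a^nb^nc^nd^nq^{\binom n2}$ in the polynomial $2^n(abcd;q)_n\,\mu_n(a,b,c,d;q)$ is $$\left[ a^n b^n c^n d^n q^{\binom n2} \right] 2^n(abcd;q)_n \mu_n(a,b,c,d;q) = \operatorname{Cat}\left(\frac n2\right),$$ where $\operatorname{Cat}(x) =\frac{1}{x+1}\binom{2x}{x}$ if $x$ is a nonnegative integer, and $\operatorname{Cat}(x)=0$ otherwise.
   Context: Let $a,b,c,d,q$ be indeterminates (generic parameters). The monic Askey-Wilson polynomials $P_n(x)=P_n(x;a,b,c,d;q)$ are defined by $P_{-1}=0$, $P_0=1$, $P_{n+1}=(x-b_n)P_n-\lambda_nP_{n-1}$, with $b_n=\frac12(a+a^{-1}-(A_n+C_n))$, $\lambda_n=\frac14A_{n-1}C_n$, where $$A_n=\frac{(1-abq^n)(1-acq^n)(1-adq^n)(1-abcdq^{n-1})}{a(1-abcdq^{2n-1})(1-abcdq^{2n})},\quad C_n=\frac{a(1-q^n)(1-bcq^{n-1})(1-bdq^{n-1})(1-cdq^{n-1})}{(1-abcdq^{2n-2})(1-abcdq^{2n-1})}$$ (for $n=0$ the common factor $1-abcdq^{-1}$ in $A_0$ is cancelled, and $C_0=0$). The moment $\mu_n(a,b,c,d;q)=L(x^n)$, where $L$ is the unique linear functional on polynomials in $x$ with $L(1)=1$ and $L(P_n)=0$ for all $n\ge1$ (so that $L(P_mP_n)=0$ for $m\neq n$). It is a rational function of $a,b,c,d,q$, and $2^n(abcd;q)_n\mu_n(a,b,c,d;q)$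 is a polynomial in $a,b,c,d,q$ with integer coefficients. Here $(x;q)_m=\prod_{i=0}^{m-1}(1-xq^i)$, and $[M]F$ denotes the coefficient of the monomial $M$ in the polynomial $F$. *)

theory Defs
  imports "HOL-Computational_Algebra.Computational_Algebra"
begin

definition q_pochhammer :: "'a::comm_ring_1 \<Rightarrow> 'a \<Rightarrow> nat \<Rightarrow> 'a" where
  "q_pochhammer x q m = (\<Prod>i<m. 1 - x * q ^ i)"

text \<open>For \<open>n = 0\<close> the common factor \<open>1 - abcd / q\<close> of numerator and denominator is cancelled.\<close>
definition aw_A :: "'a::field \<Rightarrow> 'a \<Rightarrow> 'a \<Rightarrow> 'a \<Rightarrow> 'a \<Rightarrow> nat \<Rightarrow> 'a" where
  "aw_A a b c d q n =
     (if n = 0 then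
        (1 - a*b) * (1 - a*c) * (1 - a*d) / (a * (1 - a*b*c*d))
      else
        (1 - a*b*q^n) * (1 - a*c*q^n) * (1 - a*d*q^n) * (1 - a*b*c*d*q^(n-1)) /
        (a * (1 - a*b*c*d*q^(2*n-1)) * (1 - a*b*c*d*q^(2*n))))"

definition aw_C :: "'a::field \<Rightarrow> 'a \<Rightarrow> 'a \<Rightarrow> 'a \<Rightarrow> 'a \<Rightarrow> nat \<Rightarrow> 'a" where
  "aw_C a b c d q n =
     (if n = 0 then 0
      else
        a * (1 - q^n) * (1 - b*c*q^(n-1)) * (1 - b*d*q^(n-1)) * (1 - c*d*q^(n-1)) /
        ((1 - a*b*c*d*q^(2*n-2)) * (1 - a*b*c*d*q^(2*n-1))))"

definition aw_b :: "'a::field \<Rightarrow> 'a \<Rightarrow> 'a \<Rightarrow> 'a \<Rightarrow> 'a \<Rightarrow> nat \<Rightarrow> 'a" where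
  "aw_b a b c d q n = 1 / 2 * (a + inverse a - (aw_A a b c d q n + aw_C a b c d q n))"

text \<open>Only used for \<open>n \<ge> 1\<close>.\<close>
definition aw_lambda :: "'a::field \<Rightarrow> 'a \<Rightarrow> 'a \<Rightarrow> 'a \<Rightarrow> 'a \<Rightarrow> nat \<Rightarrow> 'a" where
  "aw_lambda a b c d q n = 1 / 4 * aw_A a b c d q (n - 1) * aw_C a b c d q n"

text \<open>Since \<open>P\<^sub>-\<^sub>1 = 0\<close>, the recurrence gives \<open>P\<^sub>1 = x - b\<^sub>0\<close>.\<close>
fun askey_wilson :: "'a::field \<Rightarrow> 'a \<Rightarrow> 'a \<Rightarrow> 'a \<Rightarrow> 'a \<Rightarrow> nat \<Rightarrow> 'a poly" where
  "askey_wilson a b c d q 0 = 1"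
| "askey_wilson a b c d q (Suc 0) = [:- aw_b a b c d q 0, 1:]"
| "askey_wilson a b c d q (Suc (Suc n)) =
     [:- aw_b a b c d q (Suc n), 1:] * askey_wilson a b c d q (Suc n)
     - smult (aw_lambda a b c d q (Suc n)) (askey_wilson a b c d q n)"

definition is_moment_functional :: "(nat \<Rightarrow> 'a::field poly) \<Rightarrow> ('a poly \<Rightarrow> 'a) \<Rightarrow> bool" where
  "is_moment_functional P L \<longleftrightarrow>
     Vector_Spaces.linear smult (*) L \<and> L 1 = 1 \<and> (\<forall>n\<ge>1. L (P n) = 0)"

definition aw_functional :: "'a::field \<Rightarrow> 'a \<Rightarrow> 'a \<Rightarrow> 'a \<Rightarrow> 'a \<Rightarrow> 'a poly \<Rightarrow> 'a" where
  "aw_functional a b c d q = (THE L. is_moment_functional (askey_wilson a b c d q) L)"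

definition aw_moment :: "'a::field \<Rightarrow> 'a \<Rightarrow> 'a \<Rightarrow> 'a \<Rightarrow> 'a \<Rightarrow> nat \<Rightarrow> 'a" where
  "aw_moment a b c d q n = aw_functional a b c d q (monom 1 n)"

text \<open>The functional in \<open>aw_functional\<close> is well defined; see \<open>ex1_aw_functional\<close> below.\<close>

lemma is_moment_functional_iff:
  "is_moment_functional P L \<longleftrightarrow>
     (\<forall>p r. L (p + r) = L p + L r) \<and> (\<forall>s p. L (smult s p) = s * L p) \<and>
     L 1 = 1 \<and> (\<forall>n\<ge>1. L (P n) = 0)"
  by (auto simp: is_moment_functional_def Vector_Spaces.linear_iff vector_space_def
      smult_add_right smult_add_left algebra_simps)

fun moment_seq :: "(nat \<Rightarrow> 'a::field poly) \<Rightarrow> nat \<Rightarrow> 'a" where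
  "moment_seq P n =
     (if n = 0 then 1 else - (\<Sum>k\<leftarrow>[0..<n]. coeff (P n) k * moment_seq P k))"

declare moment_seq.simps [simp del]

lemma ex1_moment_functional:
  fixes P :: "nat \<Rightarrow> 'a::field poly"
  assumes deg: "\<And>n. degree (P n) = n" and monic: "\<And>n. lead_coeff (P n) = 1"
  shows "\<exists>!L. is_moment_functional P L"
proof (rule ex_ex1I)
  define L where "L = (\<lambda>p. \<Sum>k\<le>degree p. coeff p k * moment_seq P k)"
  have L_eq: "L p = (\<Sum>k\<le>N. coeff p k * moment_seq P k)" if "degree p \<le> N" for p N
    unfolding L_def using that
    by (intro sum.mono_neutral_left) (auto simp: coeff_eq_0)
  have "L (p + r) = L p + L r" for p r
  proof -
    define N where "N = max (degree p) (degree r)"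
    have "degree (p + r) \<le> N" by (simp add: N_def degree_add_le_max)
    then show ?thesis
      by (simp add: L_eq[of _ N] N_def sum.distrib[symmetric] algebra_simps)
  qed
  moreover have "L (smult s p) = s * L p" for s p
    by (simp add: L_eq[of "smult s p" "degree p"] degree_smult_le)
       (simp add: L_def sum_distrib_left mult.assoc)
  moreover have "L 1 = 1" by (simp add: L_def moment_seq.simps)
  moreover have "L (P n) = 0" if "n \<ge> 1" for n
  proof -
    have "L (P n) = (\<Sum>k<n. coeff (P n) k * moment_seq P k) + coeff (P n) n * moment_seq P n"
      by (simp add: L_def deg flip: lessThan_Suc_atMost)
    also have "coeff (P n) n = 1" using monic[of n] by (simp add: deg)
    also have "moment_seq P n = - (\<Sum>k<n. coeff (P n) k * moment_seq P k)"
      using that by (subst moment_seq.simps)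
        (simp add: interv_sum_list_conv_sum_set_nat atLeast0LessThan)
    finally show ?thesis by simp
  qed
  ultimately have "is_moment_functional P L"
    unfolding is_moment_functional_iff by blast
  then show "\<exists>L. is_moment_functional P L" by (rule exI[of _ L])
next
  fix L M
  assume L: "is_moment_functional P L" and M: "is_moment_functional P M"
  have "degree p < N \<Longrightarrow> L p = M p" for p N
  proof (induction N arbitrary: p)
    case (Suc n)
    define r where "r = p - smult (coeff p n) (P n)"
    have p: "p = r + smult (coeff p n) (P n)" by (simp add: r_def)
    have LMP: "L (P n) = M (P n)"
    proof (cases n)
      case 0
      then have "P n = 1"
        using deg[of 0] monic[of 0] by (metis degree_0_id one_pCons pCons_eq_iff of_nat_0 lead_coeff_1)
      then show ?thesis using L M by (simp add: is_moment_functional_iff)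
    qed (use L M in \<open>simp add: is_moment_functional_iff\<close>)
    have "L r = M r"
    proof (cases "n = 0")
      case False
      have "coeff r i = 0" if "i \<ge> n" for i
        using that Suc.prems monic[of n] deg[of n]
        by (cases "i = n") (auto simp: r_def coeff_eq_0)
      then have "degree r < n" using False
        by (metis leading_coeff_0_iff degree_0 bot_nat_0.not_eq_extremum not_le)
      then show ?thesis by (rule Suc.IH)
    next
      case True
      have "coeff r i = 0" for i
        using True Suc.prems monic[of n] deg[of n]
        by (cases "i = n") (auto simp: r_def coeff_eq_0)
      then have "r = smult 0 r" by (simp add: poly_eq_iff)
      then show ?thesis using L M unfolding is_moment_functional_iff by (metis mult_zero_left)
    qed
    then show ?case
      using L M LMP unfolding is_moment_functional_iff by (subst (1 2) p) simp
  qed simp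
  then show "L = M" by blast
qed

lemma askey_wilson_monic:
  "degree (askey_wilson a b c d q n) = n \<and> lead_coeff (askey_wilson a b c d q n) = 1"
proof (induction n rule: induct_nat_012)
  case (ge2 n)
  let ?P = "askey_wilson a b c d q"
  let ?l = "[:- aw_b a b c d q (Suc n), 1:]"
  have nz: "?P (Suc n) \<noteq> 0" using ge2 by auto
  have 1: "degree (?l * ?P (Suc n)) = Suc (Suc n)"
    using nz ge2 by (subst degree_mult_eq) auto
  have 2: "degree (smult (aw_lambda a b c d q (Suc n)) (?P n)) < Suc (Suc n)"
    using ge2 by (metis degree_smult_le le_imp_less_Suc less_SucI)
  have "degree (?P (Suc (Suc n))) = Suc (Suc n)"
    using 1 2 by (simp only: askey_wilson.simps diff_conv_add_uminus degree_add_eq_left degree_minus)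
  moreover have "coeff (?P (Suc (Suc n))) (Suc (Suc n)) = 1"
  proof -
    have "coeff (?l * ?P (Suc n)) (Suc (Suc n)) = lead_coeff (?l * ?P (Suc n))"
      using 1 by simp
    also have "\<dots> = lead_coeff (?P (Suc n))" by (simp only: lead_coeff_mult) simp
    also have "\<dots> = 1" using ge2 by blast
    finally show ?thesis
      using coeff_eq_0[OF 2] by (simp only: askey_wilson.simps coeff_diff) simp
  qed
  ultimately show ?case by simp
qed auto

corollary ex1_aw_functional: "\<exists>!L. is_moment_functional (askey_wilson a b c d q) L"
  by (rule ex1_moment_functional) (use askey_wilson_monic in blast)+

text \<open>Iterated univariate polynomials \<open>\<int>[q][d][c][b][a]\<close>: \<open>a\<close> is the outermost variable, \<open>q\<close> the innermost.\<close>
type_synonym poly5 = "int poly poly poly poly poly"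
type_synonym ratfun5 = "poly5 fract"

definition mon5 :: "nat \<Rightarrow> nat \<Rightarrow> nat \<Rightarrow> nat \<Rightarrow> nat \<Rightarrow> poly5" where
  "mon5 i j k l m = monom (monom (monom (monom (monom 1 m) l) k) j) i"

definition coeff5 :: "poly5 \<Rightarrow> nat \<Rightarrow> nat \<Rightarrow> nat \<Rightarrow> nat \<Rightarrow> nat \<Rightarrow> int" where
  "coeff5 F i j k l m = coeff (coeff (coeff (coeff (coeff F i) j) k) l) m"

definition ind_a :: ratfun5 where "ind_a = to_fract (mon5 1 0 0 0 0)"
definition ind_b :: ratfun5 where "ind_b = to_fract (mon5 0 1 0 0 0)"
definition ind_c :: ratfun5 where "ind_c = to_fract (mon5 0 0 1 0 0)"
definition ind_d :: ratfun5 where "ind_d = to_fract (mon5 0 0 0 1 0)"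
definition ind_q :: ratfun5 where "ind_q = to_fract (mon5 0 0 0 0 1)"

lemma mon5_mult: "mon5 i j k l m * mon5 i' j' k' l' m' = mon5 (i+i') (j+j') (k+k') (l+l') (m+m')"
  by (simp add: mon5_def mult_monom)

lemma coeff5_mon5:
  "coeff5 (mon5 i j k l m) i' j' k' l' m' =
     (if i = i' \<and> j = j' \<and> k = k' \<and> l = l' \<and> m = m' then 1 else 0)"
  by (simp add: coeff5_def mon5_def)

definition Cat :: "rat \<Rightarrow> rat" where
  "Cat x = (if x \<in> \<nat> then 1 / (x + 1) * of_nat ((2 * nat \<lfloor>x\<rfloor>) choose nat \<lfloor>x\<rfloor>) else 0)"

end

theory Submission
  imports Defs
begin

text \<open>Let \<open>F = 2\<^sup>n (abcd; q)\<^sub>n \<mu>\<^sub>n\<close>. The functional takes the value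
\<open>(ab, ac, ad; q)\<^sub>k / (abcd; q)\<^sub>k\<close> on \<open>(az, a/z; q)\<^sub>k\<close>, where \<open>x = (z + 1/z)/2\<close>; expanding \<open>x\<^sup>n\<close>
in these, \<open>F\<close> is a polynomial up to powers of \<open>a\<close> and \<open>q\<close> in the denominator. On the other hand
\<open>2b\<^sub>n\<close> and \<open>4\<lambda>\<^sub>n\<close> are regular at \<open>a = b = c = d = q = 0\<close> with values \<open>0\<close> and \<open>1\<close>. Hence
\<open>2\<^sup>n \<mu>\<^sub>n\<close> is regular there too, with value the number of Dyck paths of length \<open>n\<close>, and the powers
of \<open>a\<close> and \<open>q\<close> cancel. Since the recurrence is invariant under inverting all five parameters,
\<open>2\<^sup>n \<mu>\<^sub>n\<close> takes the same value at infinity, while the leading monomial of \<open>(abcd; q)\<^sub>n\<close> is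
\<open>(-1)^n (abcd)^n q^(n choose 2)\<close>. The coefficient in question is the product of the two; the sign
disappears because there are no Dyck paths of odd length.\<close>

subsection \<open>Mixed moments of the Askey-Wilson functional\<close>

text \<open>The recurrence in \<open>mixed_moment_recurrence_Suc\<close> below with \<open>K = q\<^sup>k\<close>, \<open>M = q\<^sup>m\<close>, after clearing denominators. In terms of
the elementary symmetric functions of \<open>b, c, d\<close> it is small enough for \<open>algebra\<close>.\<close>
lemma moment_ratio_identity:
  fixes a b c d q K M :: "'a::field"
  assumes s: "s = a*b*c*d" and e1: "e1 = b+c+d" and e2: "e2=b*c+b*d+c*d" and e3: "e3=b*c*d"
   and X: "X = (1-a*b*q*M)*(1-a*c*q*M)*(1-a*d*q*M)*(1-s*M)*(1 - s*M*M) + a*a*(1-q*M)*(1-b*c*M)*(1-b*d*M)*(1-c*d*M)*(1 - s*q*q*M*M)"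
   and D: "D = (1 - s*M*M)*(1 - s*q*M*M)*(1 - s*q*q*M*M)"
  shows "a*K*(a*(1-s*M)*(1-b*c*q*M)*(1-b*d*q*M)*(1-c*d*q*M)*(1 - s*M*M))*(K-M)*(K-q*M)
    = (D*(1+a^2*K^2) - K*(D*a*a + D - X))*(K-M)*(1-s*K*q*M)
     - D*M*(q*K-1)*(1-a*b*K)*(1-a*c*K)*(1-a*d*K)
     - K*((1-a*b*M)*(1-a*c*M)*(1-a*d*M)*(1-q*M)*(1 - s*q*q*M*M))*(1-s*K*M)*(1-s*K*q*M)"
proof -
  have A: "(1-a*b*Y)*(1-a*c*Y)*(1-a*d*Y) = 1 - a*e1*Y + a^2*e2*Y^2 - a^3*e3*Y^3" for Y unfolding e1 e2 e3 by algebra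
  have B: "(1-b*c*Y)*(1-b*d*Y)*(1-c*d*Y) = 1 - e2*Y + e1*e3*Y^2 - e3^2*Y^3" for Y unfolding e1 e2 e3 by algebra
  have s': "s = a*e3" by (simp add: s e3)
  have X': "X = (1 - a*e1*(q*M) + a^2*e2*(q*M)^2 - a^3*e3*(q*M)^3)*(1-a*e3*M)*(1 - a*e3*M*M) + a*a*(1-q*M)*(1 - e2*M + e1*e3*M^2 - e3^2*M^3)*(1 - a*e3*q*q*M*M)"
    unfolding X s' A[symmetric] B[symmetric] by (simp add: mult.assoc)
  have "a*K*(a*(1-a*e3*M)*(1 - e2*(q*M) + e1*e3*(q*M)^2 - e3^2*(q*M)^3)*(1 - a*e3*M*M))*(K-M)*(K-q*M)
    = (D*(1+a^2*K^2) - K*(D*a*a + D - X))*(K-M)*(1-a*e3*K*q*M)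
     - D*M*(q*K-1)*(1 - a*e1*K + a^2*e2*K^2 - a^3*e3*K^3)
     - K*((1 - a*e1*M + a^2*e2*M^2 - a^3*e3*M^3)*(1-q*M)*(1 - a*e3*q*q*M*M))*(1-a*e3*K*M)*(1-a*e3*K*q*M)"
    unfolding X' D s' by algebra
  then show ?thesis unfolding s' A[symmetric] B[symmetric] by (simp add: mult.assoc)
qed

lemma q_pochhammer_0 [simp]: "q_pochhammer x q 0 = 1"
  by (simp add: q_pochhammer_def)

lemma q_pochhammer_Suc: "q_pochhammer x q (Suc m) = q_pochhammer x q m * (1 - x * q ^ m)"
  by (simp add: q_pochhammer_def)

lemma is_moment_functional_aw: "is_moment_functional (askey_wilson a b c d q) (aw_functional a b c d q)"
  unfolding aw_functional_def by (rule theI'[OF ex1_aw_functional])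

lemma aw_functional_add: "aw_functional a b c d q (p + r) = aw_functional a b c d q p + aw_functional a b c d q r"
  and aw_functional_smult: "aw_functional a b c d q (smult x p) = x * aw_functional a b c d q p"
  and aw_functional_1: "aw_functional a b c d q 1 = 1"
  and aw_functional_askey_wilson: "n > 0 \<Longrightarrow> aw_functional a b c d q (askey_wilson a b c d q n) = 0"
  using is_moment_functional_aw[of a b c d q] by (simp_all add: is_moment_functional_iff)

lemma aw_functional_diff: "aw_functional a b c d q (p - r) = aw_functional a b c d q p - aw_functional a b c d q r"
  using aw_functional_add[of a b c d q "p - r" r] by simp

lemma X_mult_askey_wilson_0:
  "[:0, 1:] * askey_wilson a b c d q 0 = askey_wilson a b c d q (Suc 0) + smult (aw_b a b c d q 0) (askey_wilson a b c d q 0)"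
  by (simp add: one_pCons)

lemma X_mult_askey_wilson_Suc:
  "[:0, 1:] * askey_wilson a b c d q (Suc n) = askey_wilson a b c d q (Suc (Suc n))
     + smult (aw_b a b c d q (Suc n)) (askey_wilson a b c d q (Suc n))
     + smult (aw_lambda a b c d q (Suc n)) (askey_wilson a b c d q n)"
  by (simp add: algebra_simps)

text \<open>\<open>(az, a/z; q)\<^sub>k\<close> as a polynomial in \<open>x = (z + 1/z)/2\<close>.\<close>
definition aw_basis :: "'a::field \<Rightarrow> 'a \<Rightarrow> nat \<Rightarrow> 'a poly" where
  "aw_basis a q k = (\<Prod>i<k. [:1 + a^2 * (q^i)^2, - 2 * a * q^i:])"

lemma aw_basis_0 [simp]: "aw_basis a q 0 = 1"
  by (simp add: aw_basis_def)

lemma aw_basis_Suc: "aw_basis a q (Suc k) = smult (1 + a^2 * (q^k)^2) (aw_basis a q k)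
    - smult (2 * a * q^k) ([:0, 1:] * aw_basis a q k)"
  by (simp add: aw_basis_def mult.commute[of _ "[:_, _:]"] algebra_simps)

text \<open>The share of \<open>aw_lambda\<close> at index \<open>n + 1\<close> that enters the
  mixed moments when \<open>n\<close> grows by one; \<open>aw_lambda_eq\<close> shows the other
  share. For \<open>n = 0\<close> the common factor \<open>1 - abcd / q\<close> is cancelled, as in
  \<open>aw_A\<close>.\<close>

definition aw_ratio :: "'a::field \<Rightarrow> 'a \<Rightarrow> 'a \<Rightarrow> 'a \<Rightarrow> 'a \<Rightarrow> nat \<Rightarrow> 'a" where
  "aw_ratio a b c d q n =
     (if n = 0 then a * (1 - b*c) * (1 - b*d) * (1 - c*d) / (2 * (1 - a*b*c*d))
      else a * (1 - a*b*c*d*q^(n-1)) * (1 - b*c*q^n) * (1 - b*d*q^n) * (1 - c*d*q^n)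
        / (2 * (1 - a*b*c*d*q^(2*n-1)) * (1 - a*b*c*d*q^(2*n))))"

text \<open>The value of the functional on \<open>P\<^sub>n (az, a/z; q)\<^sub>k\<close>; the closed form comes from expanding \<open>P\<^sub>n\<close> in
\<open>(bz, b/z; q)\<^sub>j\<close> and summing with the \<open>q\<close>-Saalschuetz formula.\<close>
definition mixed_moment :: "'a::field \<Rightarrow> 'a \<Rightarrow> 'a \<Rightarrow> 'a \<Rightarrow> 'a \<Rightarrow> nat \<Rightarrow> nat \<Rightarrow> 'a" where
  "mixed_moment a b c d q n k = (\<Prod>i<n. aw_ratio a b c d q i * (q^k - q^i))
     * (q_pochhammer (a*b) q k * q_pochhammer (a*c) q k * q_pochhammer (a*d) q k)
     / q_pochhammer (a*b*c*d) q (n + k)"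

lemma mixed_moment_Suc_left:
  "mixed_moment a b c d q (Suc n) k = mixed_moment a b c d q n k * aw_ratio a b c d q n * (q^k - q^n) / (1 - a*b*c*d*q^k*q^n)"
  by (simp add: mixed_moment_def q_pochhammer_Suc power_add mult_ac)

text \<open>The factor \<open>i = 0\<close> is split off, and in the others
  \<open>q^(k+1) - q^(i+1) = q (q^k - q^i)\<close>.\<close>

lemma prod_power_diff_Suc:
  fixes q :: "'a::comm_ring_1"
  shows "(\<Prod>i<Suc m. q^Suc k - q^i) = (q * q^k - 1) * q^m * (\<Prod>i<m. q^k - q^i)"
proof -
  have "(\<Prod>i<Suc m. q^Suc k - q^i) = (q * q^k - 1) * (\<Prod>i<m. q * (q^k - q^i))"
    by (subst prod.lessThan_Suc_shift) (simp add: algebra_simps)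
  also have "(\<Prod>i<m. q * (q^k - q^i)) = q^m * (\<Prod>i<m. q^k - q^i)"
    by (simp add: prod.distrib)
  finally show ?thesis by (simp add: mult_ac)
qed

text \<open>Refers back to \<open>mixed_moment\<close> at \<open>m\<close> and \<open>k\<close>, to
  which every other term of the recurrence in \<open>k\<close> can be reduced as well. That common
  factor is never divided by, so its vanishing for \<open>k < m\<close> does no harm.\<close>

lemma mixed_moment_Suc_Suc:
  fixes a b c d q :: "'a::field"
  shows
  "mixed_moment a b c d q (Suc m) (Suc k) = mixed_moment a b c d q m k * aw_ratio a b c d q m * q^m * (q * q^k - 1)
     * ((1 - a*b*q^k) * (1 - a*c*q^k) * (1 - a*d*q^k)) / ((1 - a*b*c*d*q^k*q^m) * (1 - a*b*c*d*q^k*q*q^m))"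
proof -
  have "(\<Prod>i<Suc m. aw_ratio a b c d q i * (q^Suc k - q^i))
      = (\<Prod>i<m. aw_ratio a b c d q i * (q^k - q^i)) * (aw_ratio a b c d q m * ((q * q^k - 1) * q^m))"
    unfolding prod.distrib prod_power_diff_Suc by (simp add: mult_ac)
  moreover have "q_pochhammer (a*b*c*d) q (Suc m + Suc k) = q_pochhammer (a*b*c*d) q (m + k) * (1 - a*b*c*d*q^k*q^m) * (1 - a*b*c*d*q^k*q*q^m)"
    by (simp add: q_pochhammer_Suc power_add mult_ac)
  moreover have E: "T*(r*(x*y))*(A*A'*(B*B')*(C*C'))/(Z*u*v) = T*(A*B*C)/Z*r*y*x*(A'*B'*C')/(u*v)"
    for T r x y A A' B B' C C' Z u v :: 'a
    by (simp add: divide_inverse mult_ac)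
  ultimately show ?thesis unfolding mixed_moment_def q_pochhammer_Suc by (simp only: E)
qed

lemma mixed_moment_0_Suc:
  "mixed_moment a b c d q 0 (Suc k) = mixed_moment a b c d q 0 k
     * ((1 - a*b*q^k) * (1 - a*c*q^k) * (1 - a*d*q^k)) / (1 - a*b*c*d*q^k)"
  by (simp add: mixed_moment_def q_pochhammer_Suc mult_ac)

section \<open>The closed form for the mixed moments\<close>

locale aw_params =
  fixes a b c d q :: "'a::field"
  assumes a_nz: "a \<noteq> 0" and q_nz: "q \<noteq> 0" and two_nz: "(2::'a) \<noteq> 0"
    and generic: "1 - a*b*c*d*q^j \<noteq> 0"
begin

lemma power_split:
  "x * q ^ (Suc m - 1) = x * q ^ m" "x * q ^ Suc m = x * q * q ^ m"
  "x * q ^ (2 * Suc m - 2) = x * q ^ m * q ^ m" "x * q ^ (2 * Suc m - 1) = x * q * q ^ m * q ^ m"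
  "x * q ^ (2 * Suc m) = x * q * q * q ^ m * q ^ m"
  by (simp_all add: mult_2 mult_2_right power_add mult_ac)

text \<open>Separates the factor \<open>aw_ratio\<close>, which is then common to all terms of the
  recurrence in \<open>k\<close>. \<open>aw_A\<close> at \<open>0\<close> has its own formula, hence
  the case distinction.\<close>

lemma aw_lambda_eq:
  "aw_lambda a b c d q (Suc m) = aw_ratio a b c d q m *
    ((1 - a*b*q^m) * (1 - a*c*q^m) * (1 - a*d*q^m) * (1 - q*q^m)
      / (2*a*(1 - a*b*c*d*q^m*q^m) * (1 - a*b*c*d*q*q^m*q^m)))"
proof -
  have 4: "(4::'a) = 2 * 2" by simp
  have aux: "1 / 4 * (P*N/(a*D1*D2)) * (a*Q*R/(D2*D3)) = a*N*R/(2*D1*D2) * (P*Q/(2*a*D2*D3))" for P N D1 D2 D3 Q R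
    unfolding 4 using a_nz two_nz by (simp add: divide_simps)
  have pm: "x * q ^ (2 * m) = x * q ^ m * q ^ m" for x by (simp only: mult_2 power_add mult.assoc)
  show ?thesis
  proof (cases "m = 0")
    case True
    show ?thesis using aux[of "(1-a*b)*(1-a*c)*(1-a*d)" 1 1 "1 - a*b*c*d" "1-q" "(1-b*c)*(1-b*d)*(1-c*d)" "1 - a*b*c*d*q"]
      unfolding True by (simp add: aw_lambda_def aw_A_def aw_C_def aw_ratio_def mult.assoc)
  next
    case False
    have "aw_lambda a b c d q (Suc m) = 1/4 * ((1 - a*b*q^m) * (1 - a*c*q^m) * (1 - a*d*q^m) * (1 - a*b*c*d*q^(m-1)) /
        (a * (1 - a*b*c*d*q^(2*m-1)) * (1 - a*b*c*d*q^m*q^m))) * (a * (1 - q*q^m) * (1 - b*c*q^m) * (1 - b*d*q^m) * (1 - c*d*q^m) /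
        ((1 - a*b*c*d*q^m*q^m) * (1 - a*b*c*d*q*q^m*q^m)))" (is "_ = ?R")
      unfolding aw_lambda_def aw_A_def aw_C_def power_split pm if_not_P[OF False] if_not_P[OF nat.simps(3)]
        diff_Suc_1 power_Suc by (rule refl)
    also have "?R = aw_ratio a b c d q m *
      ((1 - a*b*q^m) * (1 - a*c*q^m) * (1 - a*d*q^m) * (1 - q*q^m)
      / (2*a*(1 - a*b*c*d*q^m*q^m) * (1 - a*b*c*d*q*q^m*q^m)))"
    proof -
      have r: "aw_ratio a b c d q m = a * (1 - a*b*c*d*q^(m-1)) * (1 - b*c*q^m) * (1 - b*d*q^m) * (1 - c*d*q^m)
        / (2 * (1 - a*b*c*d*q^(2*m-1)) * (1 - a*b*c*d*q^m*q^m))"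
        unfolding aw_ratio_def pm if_not_P[OF False] by (rule refl)
      show ?thesis unfolding r
        using aux[of "(1-a*b*q^m)*(1-a*c*q^m)*(1-a*d*q^m)" "1 - a*b*c*d*q^(m-1)" "1 - a*b*c*d*q^(2*m-1)" "1 - a*b*c*d*q^m*q^m" "1-q*q^m"
          "(1-b*c*q^m)*(1-b*d*q^m)*(1-c*d*q^m)" "1 - a*b*c*d*q*q^m*q^m"]
        by (simp only: mult.assoc)
    qed
    finally show ?thesis .
  qed
qed

lemma aw_ratio_Suc: "aw_ratio a b c d q (Suc m) = a * (1 - a*b*c*d*q^m) * (1 - b*c*q*q^m) * (1 - b*d*q*q^m) * (1 - c*d*q*q^m)
        / (2 * ((1 - a*b*c*d*q*q^m*q^m) * (1 - a*b*c*d*q*q*q^m*q^m)))"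
  unfolding aw_ratio_def power_split if_not_P[OF nat.simps(3)] by (simp only: mult.assoc)

lemma aw_b_Suc: "2 * aw_b a b c d q (Suc m) = a + inverse a -
    ((1-a*b*q*q^m)*(1-a*c*q*q^m)*(1-a*d*q*q^m)*(1-a*b*c*d*q^m)/(a*((1 - a*b*c*d*q*q^m*q^m)*(1 - a*b*c*d*q*q*q^m*q^m)))
         + a*(1-q*q^m)*(1-b*c*q^m)*(1-b*d*q^m)*(1-c*d*q^m)/((1 - a*b*c*d*q^m*q^m)*(1 - a*b*c*d*q*q^m*q^m)))"
proof -
  have A: "aw_A a b c d q (Suc m) = (1-a*b*q*q^m)*(1-a*c*q*q^m)*(1-a*d*q*q^m)*(1-a*b*c*d*q^m)/(a*((1 - a*b*c*d*q*q^m*q^m)*(1 - a*b*c*d*q*q*q^m*q^m)))"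
    unfolding aw_A_def power_split if_not_P[OF nat.simps(3)] by (simp only: mult.assoc)
  have C: "aw_C a b c d q (Suc m) = a*(1-q*q^m)*(1-b*c*q^m)*(1-b*d*q^m)*(1-c*d*q^m)/((1 - a*b*c*d*q^m*q^m)*(1 - a*b*c*d*q*q^m*q^m))"
    unfolding aw_C_def power_split power_Suc if_not_P[OF nat.simps(3)] by (simp only: )
  have "2 * (1 / 2 * x) = x" for x :: 'a using two_nz by simp
  then show ?thesis unfolding aw_b_def A C by (simp only:)
qed

text \<open>The closed form must obey what \<open>aw_basis_Suc\<close> and the three-term recurrence
  for \<open>x P_n\<close> imply for the functional. At \<open>n = 0\<close> there is no
  \<open>aw_lambda\<close> term and \<open>aw_A\<close> is exceptional, so this case is
  separate.\<close>

lemma mixed_moment_recurrence_0: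
  "mixed_moment a b c d q 0 (Suc k) = (1 + a^2 * (q^k)^2) * mixed_moment a b c d q 0 k
     - 2 * a * q^k * (mixed_moment a b c d q (Suc 0) k + aw_b a b c d q 0 * mixed_moment a b c d q 0 k)"
proof -
  define K where "K = q^k"
  define s where "s = a*b*c*d"
  have sK: "1 - s*K \<noteq> 0" using generic[of k] by (simp add: K_def s_def)
  have s0: "1 - s \<noteq> 0" using generic[of 0] by (simp add: s_def)
  have B: "a * (2 * aw_b a b c d q 0) = (a^2 + 1 - (1 - a*b) * (1 - a*c) * (1 - a*d) / (1 - s))"
    using two_nz a_nz s0 by (simp add: aw_b_def aw_A_def aw_C_def s_def field_simps power2_eq_square)
  define U where "U = (1-a*b*K)*(1-a*c*K)*(1-a*d*K)"
  define R where "R = a*(1-b*c)*(1-b*d)*(1-c*d)"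
  define W where "W = (1-a*b)*(1-a*c)*(1-a*d)"
  have "(1 - s) * U = (1 - s) * (1 + a^2*K^2) * (1 - s*K)
      - K * (a*R*(K-1) + ((1-s)*(a^2+1) - W) * (1 - s*K))"
    unfolding s_def U_def R_def W_def by algebra
  \<comment> \<open>Quotients become atoms multiplied by their denominators, which leaves a
    polynomial identity to \<open>algebra\<close>.\<close>
  moreover have "K - 1 = (1 - s*K) * ((K-1)/(1-s*K))" "R = (1 - s) * (R/(1 - s))" "W = (1 - s) * (W/(1 - s))"
    using sK s0 by simp_all
  ultimately have "(1 - s) * U = (1 - s) * ((1 - s*K) * ((1 + a^2*K^2)
      - K * (a*(R/(1 - s))*((K-1)/(1-s*K)) + (a^2 + 1 - W/(1-s)))))"
    by algebra
  then have key: "U / (1 - s*K) = (1 + a^2*K^2)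
      - K * (a*(R/(1 - s))*((K-1)/(1-s*K)) + a * (2 * aw_b a b c d q 0))"
    unfolding B W_def[symmetric] using sK s0 by simp
  have r: "2 * aw_ratio a b c d q 0 = R/(1 - s)"
  proof -
    have "2 * (x / (2 * y)) = x / y" for x y :: 'a using two_nz by simp
    then show ?thesis unfolding aw_ratio_def s_def R_def if_P[OF refl] .
  qed
  have "mixed_moment a b c d q 0 (Suc k) = mixed_moment a b c d q 0 k * (U / (1 - s*K))"
    unfolding mixed_moment_0_Suc U_def K_def s_def by simp
  moreover have "mixed_moment a b c d q (Suc 0) k = mixed_moment a b c d q 0 k * aw_ratio a b c d q 0 * ((K-1)/(1-s*K))"
    unfolding mixed_moment_Suc_left K_def s_def by simp
  ultimately show ?thesis
    unfolding key r[symmetric] K_def[symmetric] by algebra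
qed

lemma mixed_moment_recurrence_Suc:
  "mixed_moment a b c d q (Suc m) (Suc k) = (1 + a^2 * (q^k)^2) * mixed_moment a b c d q (Suc m) k
     - 2 * a * q^k * (mixed_moment a b c d q (Suc (Suc m)) k + aw_b a b c d q (Suc m) * mixed_moment a b c d q (Suc m) k
         + aw_lambda a b c d q (Suc m) * mixed_moment a b c d q m k)"
proof -
  define K where "K = q^k"
  define M where "M = q^m"
  define s where "s = a*b*c*d"
  have n1: "1 - s*K*M \<noteq> 0" using generic[of "k+m"] by (simp add: K_def M_def s_def power_add mult_ac)
  have n2: "1 - s*K*q*M \<noteq> 0" using generic[of "Suc (k+m)"] by (simp add: K_def M_def s_def power_add mult_ac)
  have d0: "1 - s*M*M \<noteq> 0" using generic[of "m+m"] by (simp add: K_def M_def s_def power_add mult_ac)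
  have d1: "1 - s*q*M*M \<noteq> 0" using generic[of "Suc (m+m)"] by (simp add: K_def M_def s_def power_add mult_ac)
  have d2: "1 - s*q*q*M*M \<noteq> 0" using generic[of "Suc (Suc (m+m))"] by (simp add: K_def M_def s_def power_add mult_ac)
  define D where "D = (1 - s*M*M)*(1 - s*q*M*M)*(1 - s*q*q*M*M)"
  have D: "D \<noteq> 0" using d0 d1 d2 by (simp add: D_def)
  define X where "X = (1-a*b*q*M)*(1-a*c*q*M)*(1-a*d*q*M)*(1-s*M)*(1 - s*M*M) + a*a*(1-q*M)*(1-b*c*M)*(1-b*d*M)*(1-c*d*M)*(1 - s*q*q*M*M)"
  define Y where "Y = a*(1-s*M)*(1-b*c*q*M)*(1-b*d*q*M)*(1-c*d*q*M)*(1 - s*M*M)"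
  define Z where "Z = (1-a*b*M)*(1-a*c*M)*(1-a*d*M)*(1-q*M)*(1 - s*q*q*M*M)"
  define U where "U = (1-a*b*K)*(1-a*c*K)*(1-a*d*K)"
  have 1: "2 * aw_ratio a b c d q (Suc m) = Y / D"
    unfolding aw_ratio_Suc Y_def D_def K_def[symmetric] M_def[symmetric] s_def[symmetric] using d0 d1 d2 two_nz by simp
  have 2: "a * (2 * aw_b a b c d q (Suc m)) = a*a + 1 - X / D"
  proof -
    have "a * (a + inverse a - (x/(a*(y1*y2)) + z/(y0*y1))) = a*a + 1 - (x*y0 + a*z*y2) / (y0*y1*y2)"
      if "y0 \<noteq> 0" "y1 \<noteq> 0" "y2 \<noteq> 0" for x y0 y1 y2 z
      using that a_nz by (simp add: field_simps)
    from this[OF d0 d1 d2] show ?thesis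
      unfolding aw_b_Suc X_def D_def K_def[symmetric] M_def[symmetric] s_def[symmetric] by (simp only: mult.assoc)
  qed
  have 3: "2 * a * aw_lambda a b c d q (Suc m) = aw_ratio a b c d q m * (Z / D)"
    unfolding aw_lambda_eq Z_def D_def K_def[symmetric] M_def[symmetric] s_def[symmetric] using d0 d1 d2 a_nz two_nz by simp
  have "a*K*Y*(K-M)*(K-q*M)
    = (D*(1+a^2*K^2) - K*(D*a*a + D - X))*(K-M)*(1-s*K*q*M)
     - D*M*(q*K-1)*U - K*Z*(1-s*K*M)*(1-s*K*q*M)"
    unfolding U_def Y_def Z_def mult.assoc[symmetric]
    using moment_ratio_identity[OF s_def refl refl refl X_def D_def, of K] by (simp add: mult.assoc)
  moreover have "X = D * (X/D)" "Y = D * (Y/D)" "Z = D * (Z/D)" using D by simp_all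
  ultimately have "D * (M*(q*K-1)*U) = D * (((1+a^2*K^2) - K*(a*a + 1 - X/D))*(K-M)*(1-s*K*q*M)
     - K*(Z/D)*(1-s*K*M)*(1-s*K*q*M) - a*K*(Y/D)*(K-M)*(K-q*M))"
    by algebra
  then have "M*(q*K-1)*U = ((1+a^2*K^2) - K*(a*a + 1 - X/D))*(K-M)*(1-s*K*q*M)
     - K*(Z/D)*(1-s*K*M)*(1-s*K*q*M) - a*K*(Y/D)*(K-M)*(K-q*M)"
    using D by simp
  moreover have "K - M = (1-s*K*M) * ((K-M)/(1-s*K*M))" "K - q*M = (1-s*K*q*M) * ((K-q*M)/(1-s*K*q*M))"
    using n1 n2 by simp_all
  ultimately have "M*(q*K-1)*U = ((1-s*K*M)*(1-s*K*q*M)) * (((1+a^2*K^2) - K*(a*a + 1 - X/D))*((K-M)/(1-s*K*M))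
     - K*(Z/D) - a*K*(Y/D)*((K-M)/(1-s*K*M))*((K-q*M)/(1-s*K*q*M)))"
    by algebra
  then have "M*(q*K-1)*U / ((1-s*K*M)*(1-s*K*q*M)) = ((1+a^2*K^2) - K*(a*a + 1 - X/D))*((K-M)/(1-s*K*M))
     - K*(Z/D) - a*K*(Y/D)*((K-M)/(1-s*K*M))*((K-q*M)/(1-s*K*q*M))"
    using n1 n2 by (simp only: nonzero_mult_div_cancel_left mult_eq_0_iff not_False_eq_True simp_thms)
  then have key: "M*(q*K-1)*U / ((1-s*K*M)*(1-s*K*q*M)) = ((1+a^2*K^2) - K*(a * (2 * aw_b a b c d q (Suc m))))*((K-M)/(1-s*K*M))
     - K*(Z/D) - a*K*(2 * aw_ratio a b c d q (Suc m))*((K-M)/(1-s*K*M))*((K-q*M)/(1-s*K*q*M))"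
    unfolding 1 2 .
  \<comment> \<open>Each term is now a multiple of
    \<open>mixed_moment a b c d q m k * aw_ratio a b c d q m\<close>, and \<open>key\<close> is the
    relation between the cofactors.\<close>
  have "mixed_moment a b c d q (Suc m) (Suc k) = mixed_moment a b c d q m k * aw_ratio a b c d q m * (M*(q*K-1)*U / ((1-s*K*M)*(1-s*K*q*M)))"
    unfolding mixed_moment_Suc_Suc U_def K_def s_def M_def by (simp add: mult_ac)
  moreover have "mixed_moment a b c d q (Suc m) k = mixed_moment a b c d q m k * aw_ratio a b c d q m * ((K-M)/(1-s*K*M))"
    unfolding mixed_moment_Suc_left K_def s_def M_def by simp
  moreover have "mixed_moment a b c d q (Suc (Suc m)) k = mixed_moment a b c d q (Suc m) k * aw_ratio a b c d q (Suc m) * ((K-q*M)/(1-s*K*q*M))"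
    unfolding mixed_moment_Suc_left[of _ _ _ _ _ "Suc m"] K_def s_def M_def by (simp add: mult_ac)
  moreover have "2 * a * K * (aw_lambda a b c d q (Suc m) * mixed_moment a b c d q m k) = mixed_moment a b c d q m k * aw_ratio a b c d q m * (K * (Z / D))"
    using 3 by algebra
  ultimately show ?thesis unfolding key K_def[symmetric] by algebra
qed

text \<open>Induction on \<open>k\<close> for all \<open>n\<close> together, because
  \<open>x P_n\<close> involves the neighbouring polynomials. For \<open>k = 0\<close> and
  \<open>n > 0\<close>, orthogonality to \<open>1\<close> matches the factor
  \<open>q^0 - q^0\<close> of the closed form.\<close>

lemma aw_functional_mixed:
  "aw_functional a b c d q (askey_wilson a b c d q n * aw_basis a q k) = mixed_moment a b c d q n k"
proof (induction k arbitrary: n)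
  case 0
  then show ?case
    by (cases n) (simp_all add: mixed_moment_def aw_functional_1 aw_functional_askey_wilson
      prod.lessThan_Suc_shift del: prod.lessThan_Suc)
next
  case (Suc k)
  let ?L = "aw_functional a b c d q" and ?P = "askey_wilson a b c d q" and ?f = "aw_basis a q k"
  have *: "?L (?P n * aw_basis a q (Suc k)) = (1 + a^2 * (q^k)^2) * mixed_moment a b c d q n k
      - 2 * a * q^k * ?L (([:0, 1:] * ?P n) * ?f)"
  proof -
    have "?P n * aw_basis a q (Suc k) = smult (1 + a^2 * (q^k)^2) (?P n * ?f) - smult (2 * a * q^k) (([:0, 1:] * ?P n) * ?f)"
      unfolding aw_basis_Suc by (simp add: algebra_simps)
    then show ?thesis by (simp only: aw_functional_diff aw_functional_smult Suc)
  qed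
  show ?case
  proof (cases n)
    case 0
    show ?thesis
      unfolding * unfolding 0 X_mult_askey_wilson_0 mixed_moment_recurrence_0 distrib_right mult_smult_left
        aw_functional_add aw_functional_smult Suc by (simp add: algebra_simps)
  next
    case (Suc m)
    show ?thesis
      unfolding * unfolding Suc X_mult_askey_wilson_Suc mixed_moment_recurrence_Suc distrib_right mult_smult_left
        aw_functional_add aw_functional_smult Suc.IH by (simp add: algebra_simps)
  qed
qed

lemma aw_functional_basis:
  "aw_functional a b c d q (aw_basis a q k)
     = q_pochhammer (a*b) q k * q_pochhammer (a*c) q k * q_pochhammer (a*d) q k / q_pochhammer (a*b*c*d) q k"
  using aw_functional_mixed[of 0 k] by (simp add: mixed_moment_def)

end

subsection \<open>Moments at a place\<close>

text \<open>\<open>V x z\<close>: the element \<open>x\<close> lies in a local ring with residue \<open>z\<close>.\<close>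
locale place =
  fixes V :: "'a::field \<Rightarrow> int \<Rightarrow> bool"
  assumes V_1: "V 1 1"
    and V_add: "V x z \<Longrightarrow> V y w \<Longrightarrow> V (x + y) (z + w)"
    and V_mult: "V x z \<Longrightarrow> V y w \<Longrightarrow> V (x * y) (z * w)"
    and V_uminus: "V x z \<Longrightarrow> V (- x) (- z)"
    and V_inverse: "V x 1 \<Longrightarrow> V (inverse x) 1"
    and V_1_nz: "V x 1 \<Longrightarrow> x \<noteq> 0"
begin

lemma V_diff: "V x z \<Longrightarrow> V y w \<Longrightarrow> V (x - y) (z - w)"
  using V_add[OF _ V_uminus, of x z y w] by simp

lemma V_0: "V 0 0"
  using V_diff[OF V_1 V_1] by simp

lemma V_divide: "V x z \<Longrightarrow> V y 1 \<Longrightarrow> V (x / y) z"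
  using V_mult[OF _ V_inverse, of x z y] by (simp add: divide_inverse)

lemma V_power: "V x z \<Longrightarrow> V (x ^ n) (z ^ n)"
  by (induction n) (auto intro: V_1 V_mult)

lemma V_mult_0_left: "V x 0 \<Longrightarrow> V y w \<Longrightarrow> V (x * y) 0"
  using V_mult[of x 0 y w] by simp

lemma V_mult_1: "V x 1 \<Longrightarrow> V y 1 \<Longrightarrow> V (x * y) 1"
  using V_mult[of x 1 y 1] by simp

lemma V_one_minus: "V x 0 \<Longrightarrow> V (1 - x) 1"
  using V_diff[OF V_1, of x 0] by simp

end

section \<open>Ballot numbers and Catalan numbers\<close>

text \<open>Counts the paths with \<open>n\<close> steps up or down by one from height
  \<open>k\<close> to \<open>0\<close> that stay nonnegative, according to the first step. These are
  the values on \<open>x^n P_k\<close> for the limiting recurrence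
  \<open>x P_k = P_(k+1) + P_(k-1)\<close>.\<close>

fun ballot :: "nat \<Rightarrow> nat \<Rightarrow> int" where
  "ballot 0 k = (if k = 0 then 1 else 0)"
| "ballot (Suc n) 0 = ballot n 1"
| "ballot (Suc n) (Suc k) = ballot n (Suc (Suc k)) + ballot n k"

lemma ballot_odd: "odd (n + k) \<Longrightarrow> ballot n k = 0"
  by (induction n k rule: ballot.induct) (auto simp: odd_pos)

text \<open>The reflection principle: \<open>j\<close> is the number of down steps, and the second
  binomial counts the paths that reach height \<open>-1\<close>.\<close>

lemma ballot_even: "n + k = 2 * j \<Longrightarrow> ballot n k = int (n choose j) - int (n choose Suc j)"
proof (induction n k arbitrary: j rule: ballot.induct)
  case (1 k)
  then show ?case by (cases j) auto
next
  case (2 n)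
  then obtain i where j: "j = Suc i" by (cases j) auto
  \<comment> \<open>At height \<open>0\<close>, \<open>n = 2 i + 1\<close>. The two middle binomials
    agree, so the difference that would stand for a down step vanishes.\<close>
  then have "n choose Suc i = n choose i"
    using 2 binomial_symmetric[of i n] by (simp add: algebra_simps)
  moreover have "ballot n 1 = int (n choose j) - int (n choose Suc j)"
    using 2 by simp
  ultimately show ?case by (simp add: j)
next
  case (3 n k)
  then obtain i where j: "j = Suc i" by (cases j) auto
  have "ballot n (Suc (Suc k)) = int (n choose j) - int (n choose Suc j)"
    using 3 by simp
  moreover have "ballot n k = int (n choose i) - int (n choose Suc i)"
    using 3 j by simp
  ultimately show ?case by (simp add: j)
qed

lemma ballot_eq_Cat: "of_int (ballot n 0) = Cat (of_nat n / 2)"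
proof (cases "even n")
  case True
  then obtain m where n: "n = 2 * m" by blast
  have "Suc m * (2 * m choose Suc m) = m * (2 * m choose m)"
    using binomial_absorb_comp[of "2 * m" m] binomial_absorption[of m "2 * m"] by (simp only: mult_2 diff_add_inverse)
  then have "(rat_of_nat m + 1) * of_nat (2 * m choose Suc m) = of_nat m * of_nat (2 * m choose m)"
    by (metis of_nat_mult of_nat_Suc add.commute)
  moreover have "ballot n 0 = int (2 * m choose m) - int (2 * m choose Suc m)"
    using ballot_even[of n 0 m] by (simp add: n)
  then have "rat_of_int (ballot n 0) = of_nat (2 * m choose m) - of_nat (2 * m choose Suc m)"
    by simp
  ultimately have "(of_nat m + 1) * rat_of_int (ballot n 0) = of_nat (2 * m choose m)"
    by algebra
  then have "rat_of_int (ballot n 0) = 1 / (of_nat m + 1) * of_nat (2 * m choose m)"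
    by (simp add: field_simps add_eq_0_iff)
  then show ?thesis by (simp add: Cat_def n)
next
  case False
  have "rat_of_nat n / 2 \<notin> \<nat>"
  proof
    assume "rat_of_nat n / 2 \<in> \<nat>"
    then obtain m where "rat_of_nat n / 2 = of_nat m" by (elim Nats_cases)
    then have "rat_of_nat n = of_nat (2 * m)" by (simp add: field_simps)
    then have "n = 2 * m" by (simp only: of_nat_eq_iff)
    with False show False by simp
  qed
  with False show ?thesis by (simp add: Cat_def ballot_odd)
qed

section \<open>Regularity of the recurrence coefficients and of the moments\<close>

text \<open>Stated for an arbitrary place so that it serves twice: for the five indeterminates at
  the origin and for their inverses at infinity.\<close>

locale aw_place = place V for V :: "'a::field \<Rightarrow> int \<Rightarrow> bool" +
  fixes a b c d q :: 'a
  assumes V_params: "V a 0" "V b 0" "V c 0" "V d 0" "V q 0"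
    and params_nz: "a \<noteq> 0" "q \<noteq> 0" "(2::'a) \<noteq> 0"
begin

text \<open>Membership in \<open>1 + a m\<close>, with \<open>m\<close> the kernel of the residue map: \<open>a A\<^sub>n\<close> has this property, so \<open>1/a - A\<^sub>n\<close> is
regular although both terms have a pole.\<close>
definition unit_mod_a :: "'a \<Rightarrow> bool" where
  "unit_mod_a y \<longleftrightarrow> V y 1 \<and> V ((1 - y) / a) 0"

lemma unit_mod_a_one_minus: "V u 0 \<Longrightarrow> unit_mod_a (1 - a * u)"
  using V_mult_0_left[OF V_params(1), of u 0] params_nz by (simp add: unit_mod_a_def V_one_minus)

lemma unit_mod_a_mult:
  assumes "unit_mod_a y" "unit_mod_a z" shows "unit_mod_a (y * z)"
proof -
  have "(1 - y * z) / a = (1 - y) / a + (1 - z) / a * y"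
    using params_nz by (simp add: field_simps)
  with assms show ?thesis
    using V_add[OF _ V_mult_0_left, of "(1 - y) / a" 0 "(1 - z) / a" y 1] by (simp add: unit_mod_a_def V_mult_1)
qed

lemma unit_mod_a_divide:
  assumes "unit_mod_a y" "unit_mod_a z" shows "unit_mod_a (y / z)"
proof -
  have z: "V z 1" "V ((1 - z) / a) 0" "z \<noteq> 0" using assms by (auto simp: unit_mod_a_def V_1_nz)
  have "(1 - inverse z) / a = - ((1 - z) / a) / z"
    using params_nz z by (simp add: field_simps)
  moreover have "V (- ((1 - z) / a) / z) 0" using V_divide[OF V_uminus] z by fastforce
  ultimately have "unit_mod_a (inverse z)"
    using z V_inverse by (simp add: unit_mod_a_def)
  with assms show ?thesis by (simp add: divide_inverse unit_mod_a_mult)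
qed

lemma V_mult_power_q: "V u 0 \<Longrightarrow> V (u * q ^ j) 0"
  using V_mult_0_left[OF _ V_power[OF V_params(5)]] by simp

lemma V_power_q: "j > 0 \<Longrightarrow> V (q ^ j) 0"
  using V_power[OF V_params(5), of j] by (simp add: zero_power)

lemma unit_mod_a_abcd: "unit_mod_a (1 - a * b * c * d * q ^ j)"
  using unit_mod_a_one_minus[of "b * (c * d) * q ^ j"] V_mult_power_q[of "b * (c * d)"]
    V_mult_0_left[OF V_params(2) V_mult_0_left[OF V_params(3,4)]] by (simp add: mult.assoc)

lemma unit_mod_a_mult_power: "V u 0 \<Longrightarrow> unit_mod_a (1 - a * u * q ^ j)"
  using unit_mod_a_one_minus[of "u * q ^ j"] V_mult_power_q by (simp add: mult.assoc)

sublocale aw_params a b c d q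
proof
  show "1 - a * b * c * d * q ^ j \<noteq> 0" for j
    using unit_mod_a_abcd V_1_nz unfolding unit_mod_a_def by blast
qed (use params_nz in auto)

text \<open>Once the pole is removed, every factor of numerator and denominator has the form
  \<open>1 - a u\<close> with \<open>u\<close> of residue \<open>0\<close>.\<close>

lemma unit_mod_a_A: "unit_mod_a (a * aw_A a b c d q n)"
proof -
  note u = unit_mod_a_mult unit_mod_a_mult_power unit_mod_a_abcd V_params
  show ?thesis
  proof (cases "n = 0")
    case True
    \<comment> \<open>The powers \<open>q^0\<close> put the exceptional case in the shape that the
      rules \<open>u\<close> expect.\<close>
    have "unit_mod_a ((1 - a*b*q^0) * (1 - a*c*q^0) * (1 - a*d*q^0) / (1 - a*b*c*d*q^0))"
      by (intro unit_mod_a_divide u)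
    then show ?thesis using params_nz True by (simp add: aw_A_def)
  next
    case False
    have "unit_mod_a ((1 - a*b*q^n) * (1 - a*c*q^n) * (1 - a*d*q^n) * (1 - a*b*c*d*q^(n-1)) /
        ((1 - a*b*c*d*q^(2*n-1)) * (1 - a*b*c*d*q^(2*n))))" (is "unit_mod_a ?r")
      by (intro unit_mod_a_divide u)
    moreover have "a * aw_A a b c d q n = ?r"
    proof -
      have "a * (x / (a * y * z)) = x / (y * z)" for x y z using params_nz by simp
      then show ?thesis unfolding aw_A_def if_not_P[OF False] .
    qed
    ultimately show ?thesis by simp
  qed
qed

lemma V_C:
  assumes "n > 0" shows "V (aw_C a b c d q n / a) 1"
proof -
  have "V ((1 - q^n) * (1 - b*c*q^(n-1)) * (1 - b*d*q^(n-1)) * (1 - c*d*q^(n-1)) /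
        ((1 - a*b*c*d*q^(2*n-2)) * (1 - a*b*c*d*q^(2*n-1)))) 1" (is "V ?r 1")
    using assms unit_mod_a_abcd unfolding unit_mod_a_def
    by (intro V_divide V_mult_1 V_one_minus V_mult_power_q V_power_q)
       (auto intro: V_mult_0_left V_params)
  moreover have "aw_C a b c d q n / a = ?r"
  proof -
    have "a * x1 * x2 * x3 * x4 / y / a = x1 * x2 * x3 * x4 / y" for x1 x2 x3 x4 y using params_nz by simp
    then show ?thesis using assms unfolding aw_C_def by simp
  qed
  ultimately show ?thesis by simp
qed

lemma V_b: "V (2 * aw_b a b c d q n) 0"
proof -
  have "V (aw_C a b c d q n) 0"
  proof (cases "n = 0")
    case True
    then show ?thesis by (simp add: aw_C_def V_0)
  next
    case False
    then show ?thesis using V_mult_0_left[OF V_params(1) V_C[of n]] params_nz by simp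
  qed
  then have "V (a + (1 - a * aw_A a b c d q n) / a - aw_C a b c d q n) (0 + 0 - 0)"
    using unit_mod_a_A[of n] by (intro V_diff V_add V_params) (auto simp: unit_mod_a_def)
  also have "a + (1 - a * aw_A a b c d q n) / a - aw_C a b c d q n = 2 * aw_b a b c d q n"
    using params_nz by (simp add: aw_b_def field_simps)
  finally show ?thesis by simp
qed

text \<open>The pole of \<open>aw_A\<close> at \<open>a = 0\<close> cancels against the factor
  \<open>a\<close> of \<open>aw_C\<close> at the next index.\<close>

lemma V_lambda: "V (4 * aw_lambda a b c d q (Suc n)) 1"
proof -
  have "(4::'a) = 2 * 2" by simp
  then have "(4::'a) \<noteq> 0" using params_nz by (metis mult_eq_0_iff)
  then have "4 * aw_lambda a b c d q (Suc n) = (a * aw_A a b c d q n) * (aw_C a b c d q (Suc n) / a)"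
    using params_nz by (simp add: aw_lambda_def)
  then show ?thesis
    using unit_mod_a_A[of n] V_C[of "Suc n"] by (auto simp only: unit_mod_a_def intro!: V_mult_1)
qed

text \<open>The factor \<open>2 ^ (n + k)\<close> turns the recurrence coefficients into
  \<open>2 * aw_b\<close> and \<open>4 * aw_lambda\<close>. Their residues \<open>0\<close> and
  \<open>1\<close> turn the three-term recurrence into that of \<open>ballot\<close>.\<close>

lemma V_functional:
  "V (2 ^ (n + k) * aw_functional a b c d q ([:0, 1:] ^ n * askey_wilson a b c d q k)) (ballot n k)"
proof (induction n arbitrary: k)
  case 0
  then show ?case
    by (cases k) (simp_all add: aw_functional_1 aw_functional_askey_wilson V_0 V_1)
next
  case (Suc n)
  let ?L = "aw_functional a b c d q" and ?P = "askey_wilson a b c d q"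
  let ?x = "[:0, 1:] :: 'a poly"
  have X: "?x ^ Suc n * ?P k = ?x ^ n * (?x * ?P k)"
    by (simp only: power_Suc2 mult.assoc)
  show ?case
  proof (cases k)
    case 0
    have "?x ^ Suc n * ?P 0 = ?x ^ n * ?P 1 + smult (aw_b a b c d q 0) (?x ^ n * ?P 0)"
      unfolding X[unfolded 0] X_mult_askey_wilson_0 by (simp only: distrib_left mult_smult_right One_nat_def)
    then have "2 ^ (Suc n + 0) * ?L (?x ^ Suc n * ?P 0) = 2 ^ (n + 1) * ?L (?x ^ n * ?P 1)
        + 2 * aw_b a b c d q 0 * (2 ^ (n + 0) * ?L (?x ^ n * ?P 0))"
      by (simp only: aw_functional_add aw_functional_smult) (simp add: algebra_simps)
    then show ?thesis
      using V_add[OF Suc[of 1] V_mult_0_left[OF V_b[of 0] Suc[of 0]]] unfolding 0 by simp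
  next
    case k: (Suc j)
    have "?x ^ Suc n * ?P k = ?x ^ n * ?P (Suc k) + smult (aw_b a b c d q k) (?x ^ n * ?P k)
       + smult (aw_lambda a b c d q k) (?x ^ n * ?P j)"
      unfolding X unfolding k X_mult_askey_wilson_Suc by (simp only: distrib_left mult_smult_right)
    then have "2 ^ (Suc n + k) * ?L (?x ^ Suc n * ?P k) = 2 ^ (n + Suc k) * ?L (?x ^ n * ?P (Suc k))
        + 2 * aw_b a b c d q k * (2 ^ (n + k) * ?L (?x ^ n * ?P k))
        + 4 * aw_lambda a b c d q k * (2 ^ (n + j) * ?L (?x ^ n * ?P j))"
      by (simp only: aw_functional_add aw_functional_smult) (simp add: k algebra_simps)
    moreover have "V \<dots> (ballot n (Suc k) + 0 + 1 * ballot n j)"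
      using V_b V_lambda[of j] by (intro V_add V_mult V_mult_0_left[OF _ Suc] Suc) (simp_all add: k)
    ultimately show ?thesis by (simp add: k)
  qed
qed

corollary V_moment: "V (2 ^ n * aw_moment a b c d q n) (ballot n 0)"
  using V_functional[of n 0] by (simp add: aw_moment_def monom_altdef)

end

section \<open>Invariance under inverting the parameters\<close>

text \<open>By \<open>1 - 1/u = - (1 - u) / u\<close> in each of the six factors, the signs cancel
  and the monomials collect to \<open>t\<close>.\<close>

lemma prod4_one_minus_inverse:
  fixes u v w x y z t :: "'a::field"
  assumes "u \<noteq> 0" "v \<noteq> 0" "w \<noteq> 0" "x \<noteq> 0" "y \<noteq> 0" "z \<noteq> 0" and yz: "y * z = t * (u * v * w * x)"
  shows "(1 - inverse u) * (1 - inverse v) * (1 - inverse w) * (1 - inverse x) / ((1 - inverse y) * (1 - inverse z))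
    = (1 - u) * (1 - v) * (1 - w) * (1 - x) / ((1 - y) * (1 - z)) * t"
proof -
  have e: "1 - inverse t = - (1 - t) / t" if "t \<noteq> 0" for t :: 'a
    using that by (simp add: field_simps)
  have "- u' / u * (- v' / v) * (- w' / w) * (- x' / x) / (- y' / y * (- z' / z)) = u' * v' * w' * x' / (y' * z') * (y * z / (u * v * w * x))"
    for u' v' w' x' y' z' using assms(1-6) by simp
  moreover have "y * z / (u * v * w * x) = t" using assms by simp
  ultimately show ?thesis by (simp only: e[OF assms(1)] e[OF assms(2)] e[OF assms(3)] e[OF assms(4)] e[OF assms(5)] e[OF assms(6)])
qed

lemma aw_A_inverse:
  fixes a b c d q :: "'a::field"
  assumes "a \<noteq> 0" "b \<noteq> 0" "c \<noteq> 0" "d \<noteq> 0" "q \<noteq> 0"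
  shows "aw_A (inverse a) (inverse b) (inverse c) (inverse d) (inverse q) n = aw_A a b c d q n"
proof -
  have D: "X / (a * Y * Z) = X / (Y * Z) * inverse a" for X Y Z a :: 'a by (simp add: divide_inverse)
  have i: "inverse a * (inverse a * (a * a)) = 1" using assms by (simp add: field_simps)
  show ?thesis
  proof (cases n)
    case 0
    have "1 - inverse t = - (1 - t) / t" if "t \<noteq> 0" for t :: 'a
      using that by (simp add: field_simps)
    then show ?thesis using assms unfolding 0 aw_A_def inverse_mult_distrib[symmetric]
      by (simp add: divide_simps) (simp add: algebra_simps)
  next
    case (Suc m)
    show ?thesis
      unfolding Suc aw_A_def if_not_P[OF nat.simps(3)] power_inverse inverse_mult_distrib[symmetric] D
      \<comment> \<open>This \<open>t\<close> turns the inverted prefactor \<open>a\<close> back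
        into \<open>inverse a\<close>.\<close>
      by (subst prod4_one_minus_inverse[where t = "inverse a * inverse a"])
        (use assms in \<open>simp_all add: mult_2 power_add i\<close>)
  qed
qed

lemma aw_C_inverse:
  fixes a b c d q :: "'a::field"
  assumes "a \<noteq> 0" "b \<noteq> 0" "c \<noteq> 0" "d \<noteq> 0" "q \<noteq> 0"
  shows "aw_C (inverse a) (inverse b) (inverse c) (inverse d) (inverse q) n = aw_C a b c d q n"
proof (cases n)
  case (Suc m)
  have D: "a * U * V * W * X / (Y * Z) = a * (U * V * W * X / (Y * Z))" for a U V W X Y Z :: 'a by simp
  show ?thesis
    unfolding Suc aw_C_def if_not_P[OF nat.simps(3)] power_inverse inverse_mult_distrib[symmetric] D
    by (subst prod4_one_minus_inverse[where t = "a * a"])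
      (use assms in \<open>simp_all add: mult_2 power_add\<close>)
qed (simp add: aw_C_def)

lemma aw_moment_inverse:
  fixes a b c d q :: "'a::field"
  assumes "a \<noteq> 0" "b \<noteq> 0" "c \<noteq> 0" "d \<noteq> 0" "q \<noteq> 0"
  shows "aw_moment (inverse a) (inverse b) (inverse c) (inverse d) (inverse q) n = aw_moment a b c d q n"
proof -
  have b: "aw_b (inverse a) (inverse b) (inverse c) (inverse d) (inverse q) k = aw_b a b c d q k" for k
    using assms by (simp add: aw_b_def aw_A_inverse aw_C_inverse)
  have l: "aw_lambda (inverse a) (inverse b) (inverse c) (inverse d) (inverse q) k = aw_lambda a b c d q k" for k
    using assms by (simp add: aw_lambda_def aw_A_inverse aw_C_inverse)
  have "askey_wilson (inverse a) (inverse b) (inverse c) (inverse d) (inverse q) k = askey_wilson a b c d q k" for k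
    by (induction k rule: induct_nat_012) (simp_all add: b l)
  then have "askey_wilson (inverse a) (inverse b) (inverse c) (inverse d) (inverse q) = askey_wilson a b c d q"
    by blast
  then show ?thesis by (simp add: aw_moment_def aw_functional_def)
qed

subsection \<open>The places at the origin and at infinity\<close>

lemma degree_le_coeff_mult:
  fixes p r :: "'a::comm_semiring_0 poly"
  assumes "degree p \<le> i" "degree r \<le> j"
  shows "degree (p * r) \<le> i + j \<and> coeff (p * r) (i + j) = coeff p i * coeff r j"
proof
  show "degree (p * r) \<le> i + j" using degree_mult_le[of p r] assms by simp
  show "coeff (p * r) (i + j) = coeff p i * coeff r j"
  proof (cases "degree p = i \<and> degree r = j")
    case True
    then show ?thesis using coeff_mult_degree_sum by blast
  next
    case False
    then have "degree p < i \<or> degree r < j" using assms by auto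
    moreover from this have "degree (p * r) < i + j" using degree_mult_le[of p r] assms by linarith
    ultimately show ?thesis by (auto simp: coeff_eq_0)
  qed
qed

text \<open>A nonzero top coefficient of \<open>r\<close> cannot be annihilated in a domain, so the
  degree bound of the product descends to \<open>p\<close>.\<close>

lemma degree_le_cancel:
  fixes p r :: "'a::idom poly"
  assumes "degree r \<le> j" "coeff r j \<noteq> 0" "degree (p * r) \<le> i + j"
  shows "degree p \<le> i" "coeff (p * r) (i + j) = coeff p i * coeff r j"
proof -
  have r: "degree r = j" using assms(1) le_degree[OF assms(2)] by simp
  show "degree p \<le> i"
  proof (cases "p = 0")
    case False
    with assms r show ?thesis by (subst (asm) degree_mult_eq) auto
  qed simp
  then show "coeff (p * r) (i + j) = coeff p i * coeff r j"
    using degree_le_coeff_mult assms(1) by blast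
qed

text \<open>No monomial of \<open>P\<close> is lexicographically larger than \<open>a\<^sup>i b\<^sup>j c\<^sup>k d\<^sup>l q\<^sup>m\<close>, whose coefficient is \<open>z\<close> (possibly \<open>0\<close>).\<close>
definition lead5 :: "poly5 \<Rightarrow> nat \<Rightarrow> nat \<Rightarrow> nat \<Rightarrow> nat \<Rightarrow> nat \<Rightarrow> int \<Rightarrow> bool" where
  "lead5 P i j k l m z \<longleftrightarrow> degree P \<le> i \<and> degree (coeff P i) \<le> j \<and> degree (coeff (coeff P i) j) \<le> k
     \<and> degree (coeff (coeff (coeff P i) j) k) \<le> l \<and> degree (coeff (coeff (coeff (coeff P i) j) k) l) \<le> m
     \<and> coeff5 P i j k l m = z"

lemma lead5_mult:
  assumes "lead5 P i j k l m z" "lead5 R i' j' k' l' m' w"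
  shows "lead5 (P * R) (i + i') (j + j') (k + k') (l + l') (m + m') (z * w)"
  using assms by (auto simp: lead5_def coeff5_def degree_le_coeff_mult)

lemma lead5_add:
  "lead5 P i j k l m z \<Longrightarrow> lead5 R i j k l m w \<Longrightarrow> lead5 (P + R) i j k l m (z + w)"
  by (auto simp: lead5_def coeff5_def degree_add_le)

lemma lead5_uminus: "lead5 P i j k l m z \<Longrightarrow> lead5 (- P) i j k l m (- z)"
  by (auto simp: lead5_def coeff5_def)

lemma lead5_mon5: "lead5 (mon5 i j k l m) i j k l m 1"
  by (simp add: lead5_def coeff5_mon5) (simp add: mon5_def degree_monom_le)

lemma mon5_0: "mon5 0 0 0 0 0 = 1"
  by (simp add: mon5_def)

lemma coeff5_1: "coeff5 1 0 0 0 0 0 = 1"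
  by (simp add: coeff5_def)

lemma lead5_1: "lead5 1 i j k l m (if i = 0 \<and> j = 0 \<and> k = 0 \<and> l = 0 \<and> m = 0 then 1 else 0)"
  using coeff5_mon5[of 0 0 0 0 0 i j k l m] by (auto simp: lead5_def mon5_0)

lemma coeff5_0: "coeff5 0 i j k l m = 0"
  by (simp add: coeff5_def)

text \<open>The variables are peeled off from \<open>a\<close> inwards to \<open>q\<close>. At each
  stage the leading coefficient of \<open>W\<close> in the current variable is nonzero, because the
  innermost one is \<open>1\<close>.\<close>

lemma lead5_cancel:
  assumes "lead5 W i j k l m 1" "lead5 (P * W) (i' + i) (j' + j) (k' + k) (l' + l) (m' + m) z"
  shows "coeff5 P i' j' k' l' m' = z"
proof -
  note W = assms(1)[unfolded lead5_def coeff5_def] and PW = assms(2)[unfolded lead5_def coeff5_def]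
  have nz: "coeff (coeff (coeff (coeff W i) j) k) l \<noteq> 0" "coeff (coeff (coeff W i) j) k \<noteq> 0"
     "coeff (coeff W i) j \<noteq> 0" "coeff W i \<noteq> 0" using W by auto
  have 1: "coeff (P * W) (i' + i) = coeff P i' * coeff W i"
    using degree_le_cancel(2)[of W i P i'] W PW nz by blast
  have 2: "coeff (coeff P i' * coeff W i) (j' + j) = coeff (coeff P i') j' * coeff (coeff W i) j"
    using degree_le_cancel(2)[of "coeff W i" j "coeff P i'" j'] W PW nz unfolding 1 by blast
  have 3: "coeff (coeff (coeff P i') j' * coeff (coeff W i) j) (k' + k) = coeff (coeff (coeff P i') j') k' * coeff (coeff (coeff W i) j) k"
    using degree_le_cancel(2)[of "coeff (coeff W i) j" k "coeff (coeff P i') j'" k'] W PW nz unfolding 1 2 by blast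
  have 4: "coeff (coeff (coeff (coeff P i') j') k' * coeff (coeff (coeff W i) j) k) (l' + l)
      = coeff (coeff (coeff (coeff P i') j') k') l' * coeff (coeff (coeff (coeff W i) j) k) l"
    using degree_le_cancel(2)[of "coeff (coeff (coeff W i) j) k" l "coeff (coeff (coeff P i') j') k'" l'] W PW nz unfolding 1 2 3 by blast
  have 5: "coeff (coeff (coeff (coeff (coeff P i') j') k') l' * coeff (coeff (coeff (coeff W i) j) k) l) (m' + m)
      = coeff (coeff (coeff (coeff (coeff P i') j') k') l') m' * coeff (coeff (coeff (coeff (coeff W i) j) k) l) m"
    using degree_le_cancel(2)[of "coeff (coeff (coeff (coeff W i) j) k) l" m "coeff (coeff (coeff (coeff P i') j') k') l'" m'] W PW nz
    unfolding 1 2 3 4 by force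
  show ?thesis using W PW unfolding 1 2 3 4 5 coeff5_def by simp
qed

section \<open>Residues of rational functions\<close>

text \<open>The value at \<open>a = b = c = d = q = 0\<close>. Denominators have constant term
  \<open>1\<close>, not merely a nonzero one, so that residues stay integers.\<close>

definition origin_place :: "ratfun5 \<Rightarrow> int \<Rightarrow> bool" where
  "origin_place x z \<longleftrightarrow> (\<exists>U W. x = to_fract U / to_fract W \<and> coeff5 W 0 0 0 0 0 = 1 \<and> coeff5 U 0 0 0 0 0 = z)"

text \<open>The value at infinity with respect to the lexicographic order. The coefficient of
  \<open>W\<close> is a genuine leading one, while \<open>z\<close> is \<open>0\<close> when
  \<open>U\<close> is of lower order.\<close>

definition infinity_place :: "ratfun5 \<Rightarrow> int \<Rightarrow> bool" where
  "infinity_place x z \<longleftrightarrow>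
     (\<exists>U W i j k l m. x = to_fract U / to_fract W \<and> lead5 W i j k l m 1 \<and> lead5 U i j k l m z)"

lemma coeff5_0_mult: "coeff5 (P * R) 0 0 0 0 0 = coeff5 P 0 0 0 0 0 * coeff5 R 0 0 0 0 0"
  by (simp add: coeff5_def coeff_mult_0)

lemma coeff5_0_nz: "coeff5 W i j k l m = 1 \<Longrightarrow> W \<noteq> 0"
  by (auto simp: coeff5_0)

interpretation origin: place origin_place
proof
  show "origin_place 1 1"
    unfolding origin_place_def by (rule exI[of _ 1], rule exI[of _ 1]) (simp add: coeff5_1)
next
  fix x y z w assume "origin_place x z" "origin_place y w"
  then obtain U W U' W' where *: "x = to_fract U / to_fract W" "coeff5 W 0 0 0 0 0 = 1" "coeff5 U 0 0 0 0 0 = z"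
    "y = to_fract U' / to_fract W'" "coeff5 W' 0 0 0 0 0 = 1" "coeff5 U' 0 0 0 0 0 = w"
    unfolding origin_place_def by blast
  then have "W \<noteq> 0" "W' \<noteq> 0" using coeff5_0_nz by blast+
  then have "x + y = to_fract (U * W' + U' * W) / to_fract (W * W')" "x * y = to_fract (U * U') / to_fract (W * W')"
    by (simp_all add: * field_simps)
  moreover have "coeff5 (W * W') 0 0 0 0 0 = 1" "coeff5 (U * U') 0 0 0 0 0 = z * w"
    by (simp_all add: * coeff5_0_mult)
  moreover have "coeff5 (U * W' + U' * W) 0 0 0 0 0 = coeff5 (U * W') 0 0 0 0 0 + coeff5 (U' * W) 0 0 0 0 0"
    by (simp add: coeff5_def)
  ultimately show "origin_place (x + y) (z + w)" "origin_place (x * y) (z * w)"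
    unfolding origin_place_def using * coeff5_0_mult by (metis mult_1_right)+
next
  fix x z assume "origin_place x z"
  then obtain U W where "x = to_fract U / to_fract W" "coeff5 W 0 0 0 0 0 = 1" "coeff5 U 0 0 0 0 0 = z"
    unfolding origin_place_def by blast
  then show "origin_place (- x) (- z)"
    unfolding origin_place_def by (intro exI[of _ "- U"] exI[of _ W]) (auto simp: coeff5_def)
next
  fix x assume "origin_place x 1"
  then obtain U W where *: "x = to_fract U / to_fract W" "coeff5 W 0 0 0 0 0 = 1" "coeff5 U 0 0 0 0 0 = 1"
    unfolding origin_place_def by blast
  then show "origin_place (inverse x) 1"
    unfolding origin_place_def by (intro exI[of _ W] exI[of _ U]) auto
  show "x \<noteq> 0" using * coeff5_0_nz[of U] coeff5_0_nz[of W] by auto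
qed

interpretation infinity: place infinity_place
proof
  show "infinity_place 1 1"
    unfolding infinity_place_def using lead5_1[of 0 0 0 0 0] by (intro exI[of _ 1] exI[of _ 0]) auto
next
  fix x y z w assume "infinity_place x z" "infinity_place y w"
  then obtain U W i j k l m U' W' i' j' k' l' m' where
    *: "x = to_fract U / to_fract W" "lead5 W i j k l m 1" "lead5 U i j k l m z"
    "y = to_fract U' / to_fract W'" "lead5 W' i' j' k' l' m' 1" "lead5 U' i' j' k' l' m' w"
    unfolding infinity_place_def by blast
  then have "W \<noteq> 0" "W' \<noteq> 0" using coeff5_0_nz unfolding lead5_def by blast+
  then have xy: "x + y = to_fract (U * W' + W * U') / to_fract (W * W')" "x * y = to_fract (U * U') / to_fract (W * W')"
    by (simp_all add: * field_simps)
  have W: "lead5 (W * W') (i + i') (j + j') (k + k') (l + l') (m + m') 1"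
    using lead5_mult[OF *(2,5)] by simp
  have "lead5 (U * W' + W * U') (i + i') (j + j') (k + k') (l + l') (m + m') (z * 1 + 1 * w)"
    using * by (intro lead5_add lead5_mult)
  with W xy show "infinity_place (x + y) (z + w)" unfolding infinity_place_def by (metis mult_1_left mult_1_right)
  show "infinity_place (x * y) (z * w)" unfolding infinity_place_def using xy W lead5_mult[OF *(3,6)] by blast
next
  fix x z assume "infinity_place x z"
  then obtain U W i j k l m where "x = to_fract U / to_fract W" "lead5 W i j k l m 1" "lead5 U i j k l m z"
    unfolding infinity_place_def by blast
  moreover from this have "- x = to_fract (- U) / to_fract W" by simp
  ultimately show "infinity_place (- x) (- z)"
    unfolding infinity_place_def using lead5_uminus by blast
next
  fix x assume "infinity_place x 1"
  then obtain U W i j k l m where *: "x = to_fract U / to_fract W" "lead5 W i j k l m 1" "lead5 U i j k l m 1"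
    unfolding infinity_place_def by blast
  moreover from this have "inverse x = to_fract W / to_fract U" by simp
  ultimately show "infinity_place (inverse x) 1"
    unfolding infinity_place_def by blast
  show "x \<noteq> 0" using * coeff5_0_nz[of U] coeff5_0_nz[of W] by (auto simp: lead5_def)
qed

lemmas ind_defs = ind_a_def ind_b_def ind_c_def ind_d_def ind_q_def

lemma mon5_nz: "mon5 i j k l m \<noteq> 0"
  using coeff5_mon5[of i j k l m i j k l m] by (auto simp: coeff5_0)

lemma ind_nz: "ind_a \<noteq> 0" "ind_b \<noteq> 0" "ind_c \<noteq> 0" "ind_d \<noteq> 0" "ind_q \<noteq> 0"
  by (simp_all add: ind_defs mon5_nz)

lemma two_ratfun5_nz: "(2::ratfun5) \<noteq> 0"
proof -
  have "to_fract 2 = (2::ratfun5)" using to_fract_add[of "1::poly5" 1] by (simp del: to_fract_add)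
  then show ?thesis by (metis to_fract_eq_0_iff zero_neq_numeral)
qed

interpretation origin: aw_place origin_place ind_a ind_b ind_c ind_d ind_q
proof
  have *: "origin_place (to_fract (mon5 i j k l m)) 0" if "i + j + k + l + m > 0" for i j k l m
    unfolding origin_place_def using that
    by (intro exI[of _ "mon5 i j k l m"] exI[of _ 1]) (auto simp: coeff5_mon5 coeff5_1)
  show "origin_place ind_a 0" "origin_place ind_b 0" "origin_place ind_c 0" "origin_place ind_d 0" "origin_place ind_q 0"
    by (simp_all add: ind_defs *)
qed (simp_all add: ind_nz two_ratfun5_nz)

text \<open>Here the inverses are small: \<open>1\<close> has coefficient \<open>0\<close> at every
  nonconstant monomial, so the inverse of such a monomial has residue \<open>0\<close>.\<close>

interpretation infinity: aw_place infinity_place "inverse ind_a" "inverse ind_b" "inverse ind_c" "inverse ind_d" "inverse ind_q"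
proof
  have *: "infinity_place (inverse (to_fract (mon5 i j k l m))) 0" if "i + j + k + l + m > 0" for i j k l m
  proof -
    have "lead5 1 i j k l m 0" using lead5_1[of i j k l m] that by (auto split: if_splits)
    moreover have "inverse (to_fract (mon5 i j k l m)) = to_fract 1 / to_fract (mon5 i j k l m)"
      by (simp add: divide_inverse)
    ultimately show ?thesis unfolding infinity_place_def using lead5_mon5 by blast
  qed
  show "infinity_place (inverse ind_a) 0" "infinity_place (inverse ind_b) 0" "infinity_place (inverse ind_c) 0"
    "infinity_place (inverse ind_d) 0" "infinity_place (inverse ind_q) 0"
    by (simp_all add: ind_defs *)
qed (simp_all add: ind_nz two_ratfun5_nz)

subsection \<open>Polynomiality and the leading coefficient\<close>

text \<open>The ring of integer polynomials with \<open>a\<close> and \<open>q\<close> made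
  invertible.\<close>

definition laurent :: "ratfun5 \<Rightarrow> bool" where
  "laurent y \<longleftrightarrow> (\<exists>i j P. ind_a ^ i * ind_q ^ j * y = to_fract P)"

lemma to_fract_power: "to_fract (P ^ n) = to_fract P ^ n"
  by (induction n) simp_all

lemma laurent_to_fract: "laurent (to_fract P)"
  unfolding laurent_def by (intro exI[of _ 0] exI[of _ P]) simp

lemma laurent_1: "laurent 1"
  using laurent_to_fract[of 1] by simp

lemma laurent_ind: "laurent ind_a" "laurent ind_b" "laurent ind_c" "laurent ind_d" "laurent ind_q"
  by (simp_all add: ind_defs laurent_to_fract)

lemma laurent_mult:
  assumes "laurent x" "laurent y" shows "laurent (x * y)"
proof -
  from assms obtain i j P i' j' P' where
    *: "ind_a ^ i * ind_q ^ j * x = to_fract P" "ind_a ^ i' * ind_q ^ j' * y = to_fract P'"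
    unfolding laurent_def by blast
  have "ind_a ^ (i + i') * ind_q ^ (j + j') * (x * y) = (ind_a ^ i * ind_q ^ j * x) * (ind_a ^ i' * ind_q ^ j' * y)"
    by (simp add: power_add mult_ac)
  also have "\<dots> = to_fract (P * P')" unfolding * by simp
  finally have "ind_a ^ (i + i') * ind_q ^ (j + j') * (x * y) = to_fract (P * P')" .
  then show ?thesis unfolding laurent_def by blast
qed

lemma laurent_diff:
  assumes "laurent x" "laurent y" shows "laurent (x - y)"
proof -
  from assms obtain i j P i' j' P' where
    *: "ind_a ^ i * ind_q ^ j * x = to_fract P" "ind_a ^ i' * ind_q ^ j' * y = to_fract P'"
    unfolding laurent_def by blast
  let ?m = "\<lambda>i j. mon5 1 0 0 0 0 ^ i * mon5 0 0 0 0 1 ^ j"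
  have m: "ind_a ^ i * ind_q ^ j = to_fract (?m i j)" for i j
    by (simp only: ind_defs to_fract_mult to_fract_power)
  have "ind_a ^ (i + i') * ind_q ^ (j + j') * (x - y)
      = (ind_a ^ i' * ind_q ^ j') * (ind_a ^ i * ind_q ^ j * x) - (ind_a ^ i * ind_q ^ j) * (ind_a ^ i' * ind_q ^ j' * y)"
    by (simp add: power_add algebra_simps)
  also have "\<dots> = to_fract (?m i' j' * P - ?m i j * P')"
    unfolding * unfolding m by simp
  finally show ?thesis unfolding laurent_def by blast
qed

lemma laurent_add:
  assumes "laurent x" "laurent y" shows "laurent (x + y)"
  using laurent_diff[OF assms(1) laurent_diff[OF laurent_diff[OF laurent_1 laurent_1] assms(2)]] by simp

lemma laurent_power: "laurent x \<Longrightarrow> laurent (x ^ n)"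
  by (induction n) (simp_all add: laurent_1 laurent_mult)

lemma laurent_inverse: "laurent (inverse ind_a)" "laurent (inverse ind_q)"
proof -
  show "laurent (inverse ind_a)" unfolding laurent_def
    by (rule exI[of _ 1], rule exI[of _ 0], rule exI[of _ 1]) (simp add: ind_nz)
  show "laurent (inverse ind_q)" unfolding laurent_def
    by (rule exI[of _ 0], rule exI[of _ 1], rule exI[of _ 1]) (simp add: ind_nz)
qed

lemma laurent_q_pochhammer: "laurent x \<Longrightarrow> laurent (q_pochhammer x ind_q n)"
  by (induction n) (simp_all add: q_pochhammer_Suc laurent_1 laurent_mult laurent_diff laurent_power laurent_ind)

text \<open>Solving \<open>aw_basis_Suc\<close> for \<open>x\<close> times a basis element divides
  by \<open>2 a q^k\<close>: the \<open>2\<close> is absorbed by \<open>2 ^ n\<close>, and the rest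
  is invertible. After \<open>n\<close> such steps the basis index has reached \<open>n + k\<close>,
  which explains the length of the Pochhammer symbol.\<close>

lemma laurent_functional:
  "laurent (2 ^ n * q_pochhammer (ind_a * ind_b * ind_c * ind_d) ind_q (n + k) *
     aw_functional ind_a ind_b ind_c ind_d ind_q ([:0, 1:] ^ n * aw_basis ind_a ind_q k))"
proof (induction n arbitrary: k)
  case 0
  have "q_pochhammer (ind_a * ind_b * ind_c * ind_d) ind_q k \<noteq> 0"
    using origin.generic by (simp add: q_pochhammer_def)
  then show ?case
    by (simp add: origin.aw_functional_basis laurent_mult laurent_q_pochhammer laurent_ind)
next
  case (Suc n)
  let ?L = "aw_functional ind_a ind_b ind_c ind_d ind_q" and ?f = "aw_basis ind_a ind_q"
  let ?x = "[:0, 1:] :: ratfun5 poly" and ?p = "q_pochhammer (ind_a * ind_b * ind_c * ind_d) ind_q"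
  define r where "r = inverse ind_a * inverse ind_q ^ k"
  have r: "2 * ind_a * ind_q ^ k * r = 2"
    using ind_nz by (simp add: r_def field_simps)
  have "smult (2 * ind_a * ind_q ^ k) (?x ^ Suc n * ?f k)
      = smult (1 + ind_a^2 * (ind_q^k)^2) (?x ^ n * ?f k) - ?x ^ n * ?f (Suc k)"
    unfolding aw_basis_Suc power_Suc2 by (simp only: right_diff_distrib mult_smult_right mult.assoc)
  then have *: "2 * ind_a * ind_q ^ k * ?L (?x ^ Suc n * ?f k)
      = (1 + ind_a^2 * (ind_q^k)^2) * ?L (?x ^ n * ?f k) - ?L (?x ^ n * ?f (Suc k))"
    by (metis aw_functional_smult aw_functional_diff)
  have eq: "2 * ?L (?x ^ Suc n * ?f k) = r * ((1 + ind_a^2 * (ind_q^k)^2) * ?L (?x ^ n * ?f k) - ?L (?x ^ n * ?f (Suc k)))"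
  proof -
    have "2 * ?L (?x ^ Suc n * ?f k) = 2 * ind_a * ind_q ^ k * r * ?L (?x ^ Suc n * ?f k)" unfolding r ..
    also have "\<dots> = r * (2 * ind_a * ind_q ^ k * ?L (?x ^ Suc n * ?f k))" by (simp only: mult_ac)
    finally show ?thesis unfolding * .
  qed
  have "2 ^ Suc n * ?p (Suc n + k) * ?L (?x ^ Suc n * ?f k)
     = r * ((1 + ind_a^2 * (ind_q^k)^2) * (1 - (ind_a * ind_b * ind_c * ind_d) * ind_q ^ (n + k)) * (2 ^ n * ?p (n + k) * ?L (?x ^ n * ?f k))
       - 2 ^ n * ?p (n + Suc k) * ?L (?x ^ n * ?f (Suc k)))"
  proof -
    have "2 ^ Suc n * ?p (Suc n + k) * ?L (?x ^ Suc n * ?f k)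
      = 2 ^ n * ?p (n + k) * (1 - (ind_a * ind_b * ind_c * ind_d) * ind_q ^ (n + k)) * (2 * ?L (?x ^ Suc n * ?f k))"
      by (simp add: q_pochhammer_Suc del: power_Suc) simp
    moreover have "t * p * y * (r * (e * l - l')) = r * (e * y * (t * p * l) - t * (p * y) * l')"
      for t p y e l l' :: ratfun5
      by (simp add: algebra_simps)
    ultimately show ?thesis unfolding eq add_Suc_right q_pochhammer_Suc by (simp only:)
  qed
  moreover have "laurent r" "laurent ((1 + ind_a^2 * (ind_q^k)^2) * (1 - (ind_a * ind_b * ind_c * ind_d) * ind_q ^ (n + k)))"
    unfolding r_def
    by (intro laurent_mult laurent_add laurent_diff laurent_power laurent_1 laurent_ind laurent_inverse)+
  ultimately show ?case
    by (simp only:) (intro laurent_mult[OF _ laurent_diff[OF laurent_mult[OF _ Suc.IH] Suc.IH]])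
qed

section \<open>Cancelling the powers of \<open>a\<close> and \<open>q\<close>\<close>

lemma prime_elem_X: "prime_elem ([:0, 1:] :: 'a::idom poly)"
proof -
  have dvd: "[:0, 1:] dvd p \<longleftrightarrow> coeff p 0 = 0" for p :: "'a poly"
    using monom_1_dvd_iff'[of 1 p] by (simp add: monom_altdef)
  show ?thesis
    by (rule prime_elemI) (auto simp: dvd coeff_mult_0)
qed

text \<open>Since \<open>q\<close> is the innermost variable, its primality is lifted through the
  four outer polynomial rings.\<close>

lemma prime_elem_mon5: "prime_elem (mon5 1 0 0 0 0)" "prime_elem (mon5 0 0 0 0 1)"
proof -
  have "mon5 1 0 0 0 0 = [:0, 1:]" by (simp add: mon5_def monom_Suc)
  then show "prime_elem (mon5 1 0 0 0 0)" by (simp only: prime_elem_X)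
  have "mon5 0 0 0 0 1 = [:[:[:[:[:0, 1:]:]:]:]:]" by (simp add: mon5_def monom_Suc monom_0)
  then show "prime_elem (mon5 0 0 0 0 1)" by (simp only: prime_elem_X lift_prime_elem_poly)
qed

lemma mon5_not_dvd:
  assumes "coeff5 W 0 0 0 0 0 = 1" "i + j + k + l + m > 0" shows "\<not> mon5 i j k l m dvd W"
proof
  assume "mon5 i j k l m dvd W"
  then obtain R where "W = mon5 i j k l m * R" by (elim dvdE)
  with assms show False by (auto simp: coeff5_0_mult coeff5_mon5)
qed

lemma prime_power_dvd_multD:
  fixes p :: "'a::idom"
  assumes "prime_elem p" "\<not> p dvd y" "p ^ n dvd x * y" shows "p ^ n dvd x"
  using assms
proof (induction n arbitrary: x)
  case (Suc n)
  have "p dvd x * y" by (rule dvd_trans[OF _ Suc.prems(3)]) simp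
  then have "p dvd x" using Suc.prems by (simp add: prime_elem_dvd_mult_iff)
  then obtain z where x: "x = p * z" by (elim dvdE)
  have "p \<noteq> 0" using Suc.prems(1) by (simp add: prime_elem_def)
  moreover have "p * p ^ n dvd p * (z * y)" using Suc.prems(3) unfolding x power_Suc mult.assoc .
  ultimately have "p ^ n dvd z * y" by simp
  then have "p ^ n dvd z" by (rule Suc.IH[OF Suc.prems(1,2)])
  then show ?case by (simp add: x)
qed simp

text \<open>Compares a denominator \<open>a^i q^j\<close> with one of constant term
  \<open>1\<close>. The primes \<open>a\<close> and \<open>q\<close> do not divide the latter, so
  all of \<open>a^i q^j\<close> divides the numerator \<open>P\<close>.\<close>

lemma laurent_origin_place_imp_poly:
  assumes "laurent y" "origin_place y z" shows "\<exists>F. to_fract F = y"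
proof -
  from assms(1) obtain i j P where P: "ind_a ^ i * ind_q ^ j * y = to_fract P"
    unfolding laurent_def by blast
  from assms(2) obtain U W where y: "y = to_fract U / to_fract W" and W: "coeff5 W 0 0 0 0 0 = 1"
    unfolding origin_place_def by blast
  let ?A = "mon5 1 0 0 0 0" and ?Q = "mon5 0 0 0 0 1"
  have "W \<noteq> 0" using W coeff5_0_nz by blast
  then have "to_fract (?A ^ i * ?Q ^ j * U) = to_fract (P * W)"
    using P unfolding y to_fract_mult to_fract_power by (simp add: ind_defs field_simps)
  then have eq: "P * W = ?A ^ i * (?Q ^ j * U)"
    by (simp only: to_fract_eq_iff mult.assoc)
  then have "?A ^ i dvd P * W" by simp
  from prime_power_dvd_multD[OF prime_elem_mon5(1) mon5_not_dvd[OF W] this] have "?A ^ i dvd P" by simp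
  then obtain R where R: "P = ?A ^ i * R" by (elim dvdE)
  with eq have "R * W = ?Q ^ j * U" by (simp add: mon5_nz mult.assoc)
  then have "?Q ^ j dvd R * W" by simp
  from prime_power_dvd_multD[OF prime_elem_mon5(2) mon5_not_dvd[OF W] this] have "?Q ^ j dvd R" by simp
  then obtain F where "R = ?Q ^ j * F" by (elim dvdE)
  with R have "P = ?A ^ i * ?Q ^ j * F" by simp
  with P have "ind_a ^ i * ind_q ^ j * y = ind_a ^ i * ind_q ^ j * to_fract F"
    unfolding ind_defs by (simp only: to_fract_mult to_fract_power)
  then show ?thesis using ind_nz by auto
qed

text \<open>The factor with index \<open>i\<close> has leading term \<open>- abcd q^i\<close>, and
  these exponents of \<open>q\<close> add up to \<open>n choose 2\<close>.\<close>

lemma lead5_q_pochhammer: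
  "\<exists>S. to_fract S = q_pochhammer (ind_a * ind_b * ind_c * ind_d) ind_q n \<and> lead5 S n n n n (n choose 2) ((-1) ^ n)"
proof (induction n)
  case 0
  show ?case using lead5_1[of 0 0 0 0 0] by (intro exI[of _ 1]) (simp add: numeral_2_eq_2)
next
  case (Suc n)
  then obtain S where S: "to_fract S = q_pochhammer (ind_a * ind_b * ind_c * ind_d) ind_q n" "lead5 S n n n n (n choose 2) ((-1) ^ n)"
    by blast
  let ?M = "mon5 1 1 1 1 n"
  have pow: "mon5 0 0 0 0 n = mon5 0 0 0 0 1 ^ n"
  proof (induction n)
    case (Suc n)
    then show ?case using mon5_mult[of 0 0 0 0 1 0 0 0 0 n] by simp
  qed (simp add: mon5_0)
  have "?M = mon5 1 0 0 0 0 * mon5 0 1 0 0 0 * mon5 0 0 1 0 0 * mon5 0 0 0 1 0 * mon5 0 0 0 0 1 ^ n"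
    unfolding pow[symmetric] by (simp add: mon5_mult)
  then have "to_fract (S * (1 + - ?M)) = q_pochhammer (ind_a * ind_b * ind_c * ind_d) ind_q (Suc n)"
    by (simp add: q_pochhammer_Suc S ind_defs to_fract_power)
  moreover have "lead5 (1 + - ?M) 1 1 1 1 n (0 + - 1)"
    using lead5_1[of 1 1 1 1 n] by (intro lead5_add lead5_uminus lead5_mon5) simp
  from lead5_mult[OF S(2) this] have "lead5 (S * (1 + - ?M)) (Suc n) (Suc n) (Suc n) (Suc n) (Suc n choose 2) ((-1) ^ Suc n)"
    by (simp add: numeral_2_eq_2 add.commute)
  ultimately show ?case by blast
qed

theorem theorem4p2:
  fixes n :: nat
  shows "\<exists>F :: poly5.
           to_fract F = 2 ^ n * q_pochhammer (ind_a * ind_b * ind_c * ind_d) ind_q n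
                          * aw_moment ind_a ind_b ind_c ind_d ind_q n
         \<and> of_int (coeff5 F n n n n (n choose 2)) = Cat (of_nat n / 2)"
proof -
  let ?\<mu> = "aw_moment ind_a ind_b ind_c ind_d ind_q n" and ?p = "q_pochhammer (ind_a * ind_b * ind_c * ind_d) ind_q n"
  have "laurent (2 ^ n * ?p * ?\<mu>)"
    using laurent_functional[of n 0] by (simp add: aw_moment_def monom_altdef)
  moreover have "origin_place ?p (1 ^ n)"
  proof (induction n)
    case (Suc n)
    then show ?case
      using origin.unit_mod_a_abcd[of n] by (auto simp: q_pochhammer_Suc origin.unit_mod_a_def intro: origin.V_mult_1)
  qed (simp add: origin.V_1)
  then have "origin_place (?p * (2 ^ n * ?\<mu>)) (1 ^ n * ballot n 0)"
    using origin.V_moment by (rule origin.V_mult)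
  then have "origin_place (2 ^ n * ?p * ?\<mu>) (ballot n 0)"
    by (simp add: mult_ac)
  ultimately obtain F where F: "to_fract F = 2 ^ n * ?p * ?\<mu>"
    using laurent_origin_place_imp_poly by blast
  \<comment> \<open>\<open>infinity.V_moment\<close> speaks of the inverted parameters;
    \<open>aw_moment_inverse\<close> returns to the original ones.\<close>
  have "infinity_place (2 ^ n * ?\<mu>) (ballot n 0)"
    using infinity.V_moment[of n] by (simp add: aw_moment_inverse ind_nz)
  then obtain U W i j k l m where
    UW: "2 ^ n * ?\<mu> = to_fract U / to_fract W" "lead5 W i j k l m 1" "lead5 U i j k l m (ballot n 0)"
    unfolding infinity_place_def by blast
  have "W \<noteq> 0" using UW(2) coeff5_0_nz unfolding lead5_def by blast
  obtain S where S: "to_fract S = ?p" "lead5 S n n n n (n choose 2) ((-1) ^ n)"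
    using lead5_q_pochhammer by blast
  \<comment> \<open>Clearing denominators gives an identity of polynomials, from which
    \<open>lead5_cancel\<close> removes \<open>W\<close>.\<close>
  have "to_fract (F * W) = to_fract (S * U)"
  proof -
    have "to_fract (F * W) = ?p * (2 ^ n * ?\<mu>) * to_fract W" unfolding to_fract_mult F by (simp only: mult_ac)
    also have "\<dots> = to_fract (S * U)" unfolding UW(1) using \<open>W \<noteq> 0\<close> by (simp add: S)
    finally show ?thesis .
  qed
  then have "F * W = S * U" by (simp only: to_fract_eq_iff)
  then have "coeff5 F n n n n (n choose 2) = (-1) ^ n * ballot n 0"
    using lead5_cancel[OF UW(2)] lead5_mult[OF S(2) UW(3)] by metis
  also have "\<dots> = ballot n 0"
    by (cases "even n") (simp_all add: ballot_odd)
  finally show ?thesis using F ballot_eq_Cat by metis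
qed

end
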